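(* Let $n_1,m_1,n_2,m_2$ be positive integers and let $N$ be a nonnegative integer. Let $a_1,\dots,a_{n_1}$, $x_1,\dots,x_{n_1}$, $b_1,\dots,b_{m_1}$, $y_1,\dots,y_{m_1}$, $c$, $d_1,\dots,d_{m_2}$, $w_1,\dots,w_{m_2}$, $e_1,\dots,e_{n_2}$, $z_1,\dots,z_{n_2}$, $f$ be nonzero complex numbers, generic in the sense that no denominator in the expressions below vanishes (in particular the $x_i$ are pairwise distinct, and likewise the $y_k$, the $z_p$ and the $w_s$). Put $$A=a_1\cdots a_{n_1},\quad B=b_1\cdots b_{m_1},\quad D=d_1\cdots d_{m_2},\quad E=e_1\cdots e_{n_2},$$ and assume the totally balancing condition $$\frac{AB}{c^{m_1}}=\frac{DE}{f^{n_2}}.$$ Then $$\sum_{K=0}^{N}\Phi^{n_1,m_1}_{K}\left(\begin{array}{c}\{a_i\}_{n_1}\\ \{x_i\}_{n_1}\end{array}\Big|\begin{array}{c}\{b_ky_k\}_{m_1}\\ \{cy_k\}_{m_1}\end{array}\right)\Phi^{n_2,m_2}_{N-K}\left(\begin{array}{c}\{f/e_p\}_{n_2}\\ \{z_p\}_{n_2}\end{array}\Big|\begin{array}{c}\{(f/d_s)w_s\}_{m_2}\\ \{fw_s\}_{m_2}\end{array}\right)\left(\frac{DE}{f^{n_2}}\right)^{N-K}$$ $$=\sum_{L=0}^{N}\Phi^{m_1,n_1}_{L}\left(\begin{array}{c}\{c/b_k\}_{m_1}\\ \{y_k\}_{m_1}\end{array}\Big|\begin{array}{c}\{(c/a_i)x_i\}_{n_1}\\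 \{cx_i\}_{n_1}\end{array}\right)\Phi^{m_2,n_2}_{N-L}\left(\begin{array}{c}\{d_s\}_{m_2}\\ \{w_s\}_{m_2}\end{array}\Big|\begin{array}{c}\{e_pz_p\}_{n_2}\\ \{fz_p\}_{n_2}\end{array}\right)\left(\frac{AB}{c^{m_1}}\right)^{L}.$$
   Context: Fix a complex number $q$ with $0<|q|<1$. For $k\in\mathbb N=\{0,1,2,\dots\}$, $(a)_k=(a;q)_k=\prod_{i=0}^{k-1}(1-aq^i)$. For $x=(x_1,\dots,x_n)$ and $\gamma=(\gamma_1,\dots,\gamma_n)\in\mathbb N^n$, write $|\gamma|=\gamma_1+\cdots+\gamma_n$, $$\Delta(x)=\prod_{1\le i<j\le n}(x_i-x_j),\qquad \Delta(xq^\gamma)=\prod_{1\le i<j\le n}(x_iq^{\gamma_i}-x_jq^{\gamma_j})$$ (empty products equal $1$). For positive integers $n,m$, a nonnegative integer $N$, and parameters $a_1,\dots,a_n$; $x_1,\dots,x_n$; $b_1,\dots,b_m$; $y_1,\dots,y_m$; $c$, define $$\Phi^{n,m}_N\left(\begin{array}{c}\{a_i\}_n\\ \{x_i\}_n\end{array}\Big|\begin{array}{c}\{b_ky_k\}_m\\ \{cy_k\}_m\end{array}\right)=\sum_{\gamma\in\mathbb N^n,\ |\gamma|=N}\frac{\Delta(xq^\gamma)}{\Delta(x)}\prod_{1\le i,j\le n}\frac{(a_jx_i/x_j)_{\gamma_i}}{(qx_i/x_j)_{\gamma_i}}\prod_{1\le i\le n,\,1\le k\le m}\frac{(b_kx_iy_k/(x_ny_m))_{\gamma_i}}{(cx_iy_k/(x_ny_m))_{\gamma_i}}.$$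 In every occurrence of $\Phi$, the roles of $n,m$, $a_i$, $x_i$, $b_k$, $y_k$, $c$ are played by the displayed entries; for example, in $\Phi^{m_1,n_1}_L$ of the claim, $a_i$ is replaced by $c/b_k$, $x_i$ by $y_k$, $b_k$ by $c/a_i$, $y_k$ by $x_i$, and $c$ stays $c$. *)

theory Defs
  imports Complex_Main "HOL-Library.FuncSet"
begin

text \<open>Families \<open>x\<^sub>1, \<dots>, x\<^sub>n\<close> are functions on \<open>nat\<close> of which only the values at \<open>1, \<dots>, n\<close> matter.\<close>

definition qpoch :: "complex \<Rightarrow> complex \<Rightarrow> nat \<Rightarrow> complex" where
  "qpoch q a k = (\<Prod>i<k. 1 - a * q ^ i)"

definition Delta :: "nat \<Rightarrow> (nat \<Rightarrow> complex) \<Rightarrow> complex" where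
  "Delta n x = (\<Prod>i\<in>{1..n}. \<Prod>j\<in>{i<..n}. x i - x j)"

text \<open>Functions in \<open>multi_indices n N\<close> are extensional, so each
  \<open>\<gamma> \<in> \<nat>\<^sup>n\<close> with \<open>|\<gamma>| = N\<close> is represented exactly once.\<close>

definition multi_indices :: "nat \<Rightarrow> nat \<Rightarrow> (nat \<Rightarrow> nat) set" where
  "multi_indices n N = {\<gamma> \<in> {1..n} \<rightarrow>\<^sub>E UNIV. (\<Sum>i\<in>{1..n}. \<gamma> i) = N}"

lemma finite_multi_indices: "finite (multi_indices n N)"
proof (rule finite_subset)
  show "multi_indices n N \<subseteq> {1..n} \<rightarrow>\<^sub>E {..N}"
  proof
    fix \<gamma> assume g: "\<gamma> \<in> multi_indices n N"
    then have "\<gamma> i \<le> N" if "i \<in> {1..n}" for i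
      using member_le_sum[of i "{1..n}" \<gamma>] that by (auto simp: multi_indices_def)
    with g show "\<gamma> \<in> {1..n} \<rightarrow>\<^sub>E {..N}"
      by (auto simp: multi_indices_def PiE_iff)
  qed
qed (simp add: finite_PiE)

definition Phi ::
  "complex \<Rightarrow> nat \<Rightarrow> nat \<Rightarrow> nat \<Rightarrow> (nat \<Rightarrow> complex) \<Rightarrow> (nat \<Rightarrow> complex)
    \<Rightarrow> (nat \<Rightarrow> complex) \<Rightarrow> (nat \<Rightarrow> complex) \<Rightarrow> complex \<Rightarrow> complex" where
  "Phi q n m N a x b y c =
    (\<Sum>\<gamma>\<in>multi_indices n N.
      Delta n (\<lambda>i. x i * q ^ \<gamma> i) / Delta n x
      * (\<Prod>i\<in>{1..n}. \<Prod>j\<in>{1..n}.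
          qpoch q (a j * x i / x j) (\<gamma> i) / qpoch q (q * x i / x j) (\<gamma> i))
      * (\<Prod>i\<in>{1..n}. \<Prod>k\<in>{1..m}.
          qpoch q (b k * x i * y k / (x n * y m)) (\<gamma> i)
          / qpoch q (c * x i * y k / (x n * y m)) (\<gamma> i)))"

text \<open>Genericity: no denominator in the sum defining \<open>Phi q n m N a x b y c\<close> vanishes.
  The denominators do not involve \<open>a\<close> and \<open>b\<close>. The numbers \<open>x i\<close> and \<open>y k\<close>, by which
  one also divides, are assumed nonzero separately.\<close>

definition Phi_generic ::
  "complex \<Rightarrow> nat \<Rightarrow> nat \<Rightarrow> nat \<Rightarrow> (nat \<Rightarrow> complex) \<Rightarrow> (nat \<Rightarrow> complex) \<Rightarrow> complex \<Rightarrow> bool" where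
  "Phi_generic q n m N x y c \<longleftrightarrow>
    Delta n x \<noteq> 0 \<and>
    (\<forall>\<gamma>\<in>multi_indices n N. \<forall>i\<in>{1..n}.
      (\<forall>j\<in>{1..n}. qpoch q (q * x i / x j) (\<gamma> i) \<noteq> 0) \<and>
      (\<forall>k\<in>{1..m}. qpoch q (c * x i * y k / (x n * y m)) (\<gamma> i) \<noteq> 0))"

lemma Delta_nonzero_iff: "Delta n x \<noteq> 0 \<longleftrightarrow> inj_on x {1..n}"
proof
  assume "Delta n x \<noteq> 0"
  then have ne: "x i \<noteq> x j" if "i \<in> {1..n}" "j \<in> {1..n}" "i < j" for i j
    using that by (auto simp: Delta_def)
  show "inj_on x {1..n}"
  proof (rule inj_onI)
    fix i j assume "i \<in> {1..n}" "j \<in> {1..n}" "x i = x j"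
    then show "i = j" using ne[of i j] ne[of j i] by (cases i j rule: linorder_cases) auto
  qed
next
  assume "inj_on x {1..n}"
  then show "Delta n x \<noteq> 0"
    by (auto simp: Delta_def inj_on_eq_iff)
qed

end

theory Submission
  imports Defs "HOL-Computational_Algebra.Polynomial" "HOL-Computational_Algebra.Formal_Power_Series"
begin

text \<open>The identity is two instances of Kajihara's Euler transformation glued together by the associativity
of the Cauchy product. Put \<open>\<kappa> = A B / c\<^sup>m\<close>. In terms of the generating function
\<open>F(u) = (\<Sum>K. \<Phi>\<^sub>K u^K)\<close> of the sums with data \<open>(a, x | b, y; c)\<close> and the generating function \<open>G(u)\<close>
of the dual sums with data \<open>(c/b, y | c/a, x; c)\<close>, the transformation reads
\<open>F(u) = R(u) G(\<kappa> u)\<close>, where \<open>R(u) = (\<Sum>k. (\<kappa>)\<^sub>k / (q)\<^sub>k u^k)\<close> depends on nothing but \<open>\<kappa>\<close> and \<open>q\<close>. Let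
\<open>F'\<close> and \<open>G'\<close> be the series of the data \<open>(d, w | e, z; f)\<close>, so \<open>F'(u) = R'(u) G'(\<kappa>' u)\<close>. The
balancing condition says \<open>\<kappa> = \<kappa>'\<close>, hence \<open>R = R'\<close> and
\<open>F(u) G'(\<kappa> u) = R(u) G(\<kappa> u) G'(\<kappa> u) = G(\<kappa> u) F'(u)\<close>. The coefficient of \<open>u^N\<close> is the claim.

The Euler transformation (\<open>euler_transformation\<close>) is proved by induction on \<open>N\<close>. A multi-index
\<open>\<gamma>\<close> is regarded as a diagram with \<open>\<gamma> i\<close> boxes in row \<open>i\<close>, the box number \<open>s = 0, 1, \<dots>\<close> of row \<open>i\<close> carrying
the content \<open>x i * q ^ s\<close>. Then \<open>\<Phi>\<close> is a sum over diagrams with \<open>N\<close> boxes of a factor depending on \<open>q\<close>, \<open>x\<close>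
and \<open>\<gamma>\<close> alone times the product over the boxes of the values \<open>h(content)\<close> of one rational function \<open>h\<close>, with
poles at the points \<open>1 / w k\<close>. It is normalised so that \<open>h(z) / (\<Prod>j. 1 - z / x\<^sub>j)\<close> has the values
\<open>1\<close> at zero and \<open>\<kappa>\<close> at infinity. With
\<open>C\<^sub>i = h(x\<^sub>i) / (\<Prod>j\<noteq>i. 1 - x\<^sub>i / x\<^sub>j)\<close> there are two rules:

\<^item> Removing the first box of a row (\<open>box_sum_recursion\<close>) gives
  \<open>(1 - q^N) F\<^sub>N(x) = (\<Sum>i. C\<^sub>i F\<^sub>N\<^sub>-\<^sub>1(x\<^sub>i \<mapsto> q x\<^sub>i))\<close>.

\<^item> Adding a box at the end of a row of the dual diagram (\<open>dual_box_sum_recursion\<close>) gives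
  \<open>q^L (\<Sum>i. C\<^sub>i G\<^sub>L(x\<^sub>i \<mapsto> q x\<^sub>i)) = (q^L - \<kappa>) G\<^sub>L(x) + (1 - q^(L+1)) \<kappa> G\<^sub>L\<^sub>+\<^sub>1(x)\<close>.

The substitution \<open>x\<^sub>i \<mapsto> q x\<^sub>i\<close> turns \<open>\<kappa>\<close> into \<open>q \<kappa>\<close>. Inserting the induction hypothesis in the
first rule and then applying the second leaves a rational identity in \<open>q^L\<close>, \<open>q^N\<close> and \<open>\<kappa>\<close> for each coefficient
of \<open>G\<^sub>L\<close>. Both rules are instances of one partial fraction expansion (\<open>partial_fractions\<close>). In the
second rule the poles \<open>x\<^sub>i\<close> and the poles \<open>1 / (w\<^sub>k q^\<gamma>\<^sub>k)\<close> occur together: the values at zero and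
infinity produce the term with \<open>G\<^sub>L\<close>, the second group of poles the term with \<open>G\<^sub>L\<^sub>+\<^sub>1\<close>.\<close>

section \<open>Partial fractions\<close>

lemma coeff_prod_linear:
  fixes g :: "'b \<Rightarrow> 'a::field"
  assumes "finite J"
  shows "degree (\<Prod>l\<in>J. [:1, - g l:]) \<le> card J"
    and "coeff (\<Prod>l\<in>J. [:1, - g l:]) (card J) = (\<Prod>l\<in>J. - g l)"
proof -
  have deg: "degree (\<Prod>l\<in>J. [:1, - g l:]) \<le> card J" if "finite J" for J
    using that
  proof induction
    case (insert l J)
    have "degree ([:1, - g l:] * (\<Prod>l\<in>J. [:1, - g l:])) \<le> 1 + card J"
      by (rule order_trans[OF degree_mult_le]) (use insert in \<open>auto intro: add_mono\<close>)
    then show ?case using insert by simp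
  qed simp
  show "degree (\<Prod>l\<in>J. [:1, - g l:]) \<le> card J" by (rule deg) (rule assms)
  show "coeff (\<Prod>l\<in>J. [:1, - g l:]) (card J) = (\<Prod>l\<in>J. - g l)"
    using assms
  proof induction
    case (insert l J)
    have "coeff (\<Prod>l\<in>J. [:1, - g l:]) (Suc (card J)) = 0"
      using deg[of J] insert by (intro coeff_eq_0) auto
    then show ?case using insert by simp
  qed simp
qed

text \<open>The rational function \<open>g(z) = (\<Prod>l. (1 - \<beta> l * z) / (1 - z / t l))\<close> has simple poles at the points \<open>t j\<close>.
Its partial fraction expansion expresses \<open>g(0) - g(\<infinity>)\<close>, the right-hand side, as the sum of the coefficients of
\<open>1 / (1 - z / t j)\<close>. In polynomial form: both sides of Lagrange's interpolation formula for
the numerator, corrected by a multiple of the denominator so that its degree drops below \<open>card J\<close>, are evaluated at \<open>0\<close>.\<close>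

lemma partial_fractions:
  fixes t \<beta> :: "'b \<Rightarrow> 'a::field"
  assumes fin: "finite J" and inj: "inj_on t J" and nz: "\<And>j. j \<in> J \<Longrightarrow> t j \<noteq> 0"
  shows "(\<Sum>j\<in>J. (\<Prod>l\<in>J. 1 - \<beta> l * t j) / (\<Prod>l\<in>J - {j}. 1 - t j / t l))
    = 1 - (\<Prod>j\<in>J. \<beta> j * t j)"
proof (cases "J = {}")
  case False
  define \<kappa> where "\<kappa> = (\<Prod>j\<in>J. \<beta> j * t j)"
  define P where "P = (\<Prod>l\<in>J. [:1, - \<beta> l:]) - smult \<kappa> (\<Prod>l\<in>J. [:1, - (1 / t l):])"
  define c where "c j = (\<Prod>l\<in>J. 1 - \<beta> l * t j) / (\<Prod>l\<in>J - {j}. 1 - t j / t l)" for j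
  define Q where "Q = (\<Sum>j\<in>J. smult (c j) (\<Prod>l\<in>J - {j}. [:1, - (1 / t l):]))"
  have card: "card J > 0" using fin False by (simp add: card_gt_0_iff)
  have root: "(\<Prod>l\<in>K. 1 - t j / t l) = 0" if "j \<in> K" "K \<subseteq> J" for j K
    using that nz[of j] fin by (intro prod_zero) (auto intro: finite_subset)
  have nonroot: "(\<Prod>l\<in>J - {j}. 1 - t j / t l) \<noteq> 0" if "j \<in> J" for j
    using that nz inj fin by (auto simp: inj_on_eq_iff)
  have "P = Q"
  proof (rule poly_eqI_degree[where A = "t ` J"])
    fix z assume "z \<in> t ` J"
    then obtain j where j: "j \<in> J" "z = t j" by auto
    have "poly P z = (\<Prod>l\<in>J. 1 - \<beta> l * t j)"
      using root[OF j(1) order_refl] j by (simp add: P_def poly_prod mult.commute)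
    moreover have "poly Q z = (\<Sum>i\<in>J. if i = j then c j * (\<Prod>l\<in>J - {j}. 1 - t j / t l) else 0)"
      unfolding Q_def poly_sum using j root
      by (intro sum.cong) (auto simp: poly_prod)
    ultimately show "poly P z = poly Q z"
      using nonroot[OF j(1)] j fin by (simp add: c_def sum.delta)
  next
    have "coeff P (card J) = 0"
    proof -
      have "\<kappa> * (\<Prod>l\<in>J. - (1 / t l)) = (\<Prod>l\<in>J. - \<beta> l)"
        unfolding \<kappa>_def prod.distrib[symmetric] using nz by (intro prod.cong) auto
      then show ?thesis
        unfolding P_def coeff_diff coeff_smult coeff_prod_linear(2)[OF fin] by simp
    qed
    moreover have "degree P \<le> card J"
      unfolding P_def by (intro degree_diff_le order_trans[OF degree_smult_le]
          coeff_prod_linear(1) fin)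
    ultimately have "degree P < card J"
      using card by (metis coeff_0 le_neq_implies_less leading_coeff_0_iff degree_0)
    then show "degree P < card (t ` J)" by (simp add: card_image inj)
  next
    have "degree Q \<le> card J - 1"
      unfolding Q_def
      by (intro degree_sum_le fin order_trans[OF degree_smult_le]
          order_trans[OF coeff_prod_linear(1)]) (use fin in auto)
    then show "degree Q < card (t ` J)" using card by (simp add: card_image inj)
  qed
  then have "poly P 0 = poly Q 0" by simp
  then show ?thesis
    by (simp add: P_def Q_def poly_prod poly_sum c_def \<kappa>_def)
qed simp

section \<open>Vandermonde products and shifted factorials\<close>

lemma Delta_Suc: "Delta (Suc n) x = Delta n x * (\<Prod>a\<in>{1..n}. x a - x (Suc n))"
proof -
  have "{i<..Suc n} = insert (Suc n) {i<..n}" if "i \<in> {1..n}" for i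
    using that by auto
  then have "(\<Prod>i\<in>{1..n}. \<Prod>j\<in>{i<..Suc n}. x i - x j)
      = (\<Prod>i\<in>{1..n}. (x i - x (Suc n)) * (\<Prod>j\<in>{i<..n}. x i - x j))"
    by (intro prod.cong) auto
  then show ?thesis by (simp add: Delta_def prod.distrib mult.commute)
qed

text \<open>The quotient of \<open>Delta n (x(i := t))\<close> and \<open>Delta n x\<close> is free of the signs that depend on the position of \<open>i\<close>
in the ordering, since each factor containing \<open>x i\<close> changes its sign together with the corresponding
factor containing \<open>t\<close>. Through this formula the ordering of the variables disappears from the argument.\<close>

lemma Delta_fun_upd:
  assumes "i \<in> {1..n}"
  shows "Delta n (x(i := t)) * (\<Prod>j\<in>{1..n} - {i}. x i - x j)
    = Delta n x * (\<Prod>j\<in>{1..n} - {i}. t - x j)"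
  using assms
proof (induction n)
  case (Suc n)
  show ?case
  proof (cases "i = Suc n")
    case True
    have s: "{1..Suc n} - {Suc n} = {1..n}" by auto
    have d: "Delta n (x(Suc n := t)) = Delta n x"
      by (simp add: Delta_def)
    have neg: "(\<Prod>a\<in>{1..n}. x a - r) = (-1) ^ n * (\<Prod>a\<in>{1..n}. r - x a)" for r
      using prod.distrib[of "\<lambda>_. -1" "\<lambda>a. r - x a" "{1..n}"] by simp
    have eq: "(\<Prod>a\<in>{1..n}. (x(Suc n := t)) a - (x(Suc n := t)) (Suc n)) = (\<Prod>a\<in>{1..n}. x a - t)"
      by (intro prod.cong) auto
    show ?thesis
      unfolding True s Delta_Suc d eq neg[of t] neg[of "x (Suc n)"] by (simp only: mult_ac)
  next
    case False
    then have i: "i \<in> {1..n}" using Suc by auto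
    have s: "{1..Suc n} - {i} = insert (Suc n) ({1..n} - {i})" using False by auto
    have split: "(\<Prod>a\<in>{1..n}. f a) = f i * (\<Prod>a\<in>{1..n} - {i}. f a)" for f :: "nat \<Rightarrow> complex"
      using i by (intro prod.remove) auto
    define R where "R = (\<Prod>a\<in>{1..n} - {i}. x a - x (Suc n))"
    have "Delta (Suc n) (x(i := t)) = Delta n (x(i := t)) * ((t - x (Suc n)) * R)"
      unfolding Delta_Suc split R_def using False
      by (intro arg_cong2[where f = "(*)"] prod.cong) auto
    moreover have "Delta (Suc n) x = Delta n x * ((x i - x (Suc n)) * R)"
      unfolding Delta_Suc split R_def ..
    moreover have "(\<Prod>j\<in>{1..Suc n} - {i}. r - x j) = (r - x (Suc n)) * (\<Prod>j\<in>{1..n} - {i}. r - x j)" for r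
      unfolding s by simp
    ultimately show ?thesis
      using arg_cong[OF Suc.IH[OF i], of "\<lambda>z. z * ((t - x (Suc n)) * R * (x i - x (Suc n)))"]
      by (simp only: mult_ac)
  qed
qed simp

lemma Delta_scale:
  assumes "r \<noteq> 0"
  shows "Delta n (\<lambda>i. r * x i) / Delta n (\<lambda>i. r * y i) = Delta n x / Delta n y"
proof -
  have "Delta n (\<lambda>i. r * u i) = (\<Prod>i\<in>{1..n}. \<Prod>j\<in>{i<..n}. r) * Delta n u" for u
    by (simp add: Delta_def prod.distrib[symmetric] right_diff_distrib del: prod_constant)
  then show ?thesis using assms by simp
qed

lemma qpoch_0 [simp]: "qpoch q a 0 = 1"
  by (simp add: qpoch_def)

lemma qpoch_Suc: "qpoch q a (Suc k) = qpoch q a k * (1 - a * q ^ k)"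
  by (simp add: qpoch_def)

lemma qpoch_Suc': "qpoch q a (Suc k) = (1 - a) * qpoch q (q * a) k"
  by (simp add: qpoch_def prod.lessThan_Suc_shift mult_ac del: prod.lessThan_Suc)

lemma qpoch_shift: "qpoch q (q * a) k * (1 - a) = qpoch q a k * (1 - a * q ^ k)"
  using qpoch_Suc[of q a k] qpoch_Suc'[of q a k] by (simp add: mult.commute)

lemma qpoch_eq_0_iff: "qpoch q a k = 0 \<longleftrightarrow> (\<exists>s<k. a * q ^ s = 1)"
  by (auto simp: qpoch_def)

section \<open>Separated points\<close>

text \<open>Genericity in the form in which it is inherited by the induction: none of the geometric progressions
\<open>x i, x i * q, \<dots>, x i * q ^ N\<close> meets a starting point, except at its own start. The case \<open>i = j\<close> excludes
roots of unity of small order. Moving one point to \<open>q * x i\<close> costs one unit of \<open>N\<close>.\<close>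

definition separated :: "complex \<Rightarrow> nat \<Rightarrow> nat \<Rightarrow> (nat \<Rightarrow> complex) \<Rightarrow> bool" where
  "separated q n N x \<longleftrightarrow> (\<forall>i\<in>{1..n}. x i \<noteq> 0) \<and>
    (\<forall>i\<in>{1..n}. \<forall>j\<in>{1..n}. \<forall>s\<le>N. x i * q ^ s = x j \<longrightarrow> i = j \<and> s = 0)"

lemma separated_nonzero: "separated q n N x \<Longrightarrow> i \<in> {1..n} \<Longrightarrow> x i \<noteq> 0"
  unfolding separated_def by blast

lemma separated_mono: "separated q n N x \<Longrightarrow> M \<le> N \<Longrightarrow> separated q n M x"
  unfolding separated_def by (meson order_trans)

lemma separated_Delta: "separated q n N x \<Longrightarrow> Delta n x \<noteq> 0"
  unfolding Delta_nonzero_iff inj_on_def separated_def by (metis le0 mult_1_right power_0)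

lemma separated_power_eq:
  assumes "separated q n N x" "i \<in> {1..n}" "j \<in> {1..n}" "q \<noteq> 0" "r \<le> N" "s \<le> N"
    and eq: "x i * q ^ r = x j * q ^ s"
  shows "i = j \<and> r = s"
proof -
  have *: "i = j \<and> r = s"
    if "i \<in> {1..n}" "j \<in> {1..n}" "r \<le> s" "s \<le> N" "x i * q ^ r = x j * q ^ s" for i j r s
  proof -
    have "q ^ s = q ^ r * q ^ (s - r)" using that by (simp flip: power_add)
    then have "x j * q ^ (s - r) = x i" using that \<open>q \<noteq> 0\<close> by (simp add: mult_ac)
    moreover have "s - r \<le> N" using that by simp
    ultimately have "j = i \<and> s - r = 0"
      using that assms(1) unfolding separated_def by blast
    then show ?thesis using that by simp
  qed
  show ?thesis using *[of i j r s] *[of j i s r] assms by (cases "r \<le> s") auto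
qed

lemma separated_step:
  assumes sep: "separated q n (Suc N) x" and "q \<noteq> 0"
  shows "separated q n N (x(i := q * x i))"
  unfolding separated_def
proof (intro conjI ballI allI impI)
  fix k assume "k \<in> {1..n}"
  then show "(x(i := q * x i)) k \<noteq> 0" using assms separated_nonzero[OF sep] by simp
next
  fix k j s assume k: "k \<in> {1..n}" and j: "j \<in> {1..n}" and s: "s \<le> N"
    and eq: "(x(i := q * x i)) k * q ^ s = (x(i := q * x i)) j"
  have "x k * q ^ (s + (if k = i then 1 else 0)) = x j * q ^ (if j = i then 1 else 0)"
    using eq by (auto simp: mult_ac split: if_splits)
  then have "k = j \<and> s + (if k = i then 1 else 0) = (if j = i then 1 else 0)"
    using s by (intro separated_power_eq[OF sep k j \<open>q \<noteq> 0\<close>]) auto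
  then show "k = j" "s = 0" by (auto split: if_splits)
qed

lemma separated_scale:
  assumes sep: "separated q n N x" and "r \<noteq> 0"
  shows "separated q n N (\<lambda>i. r * x i)"
  unfolding separated_def
proof (intro conjI ballI allI impI)
  fix i assume "i \<in> {1..n}"
  then show "r * x i \<noteq> 0" using separated_nonzero[OF sep] \<open>r \<noteq> 0\<close> by simp
next
  fix i j s assume ij: "i \<in> {1..n}" "j \<in> {1..n}" and s: "s \<le> N" and eq: "r * x i * q ^ s = r * x j"
  have "x i * q ^ s = x j" using eq \<open>r \<noteq> 0\<close> by (simp add: mult.assoc)
  then have "i = j \<and> s = 0" using sep ij s unfolding separated_def by blast
  then show "i = j" "s = 0" by auto
qed

section \<open>Sums over diagrams\<close>

lemma multi_indices_le: "\<gamma> \<in> multi_indices n N \<Longrightarrow> i \<in> {1..n} \<Longrightarrow> \<gamma> i \<le> N"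
  using member_le_sum[of i "{1..n}" \<gamma>] by (auto simp: multi_indices_def)

text \<open>Adding a box to row \<open>i\<close> is a bijection onto the diagrams whose row \<open>i\<close> is nonempty. A summand that
vanishes on an empty row therefore can be summed over all larger diagrams.\<close>

lemma sum_multi_indices_add_box:
  fixes f :: "(nat \<Rightarrow> nat) \<Rightarrow> 'a::comm_monoid_add"
  assumes i: "i \<in> {1..n}" and f0: "\<And>\<gamma>. \<gamma> i = 0 \<Longrightarrow> f \<gamma> = 0"
  shows "(\<Sum>\<gamma>\<in>multi_indices n N. f (\<gamma>(i := Suc (\<gamma> i)))) = (\<Sum>\<gamma>\<in>multi_indices n (Suc N). f \<gamma>)"
proof -
  have split: "sum \<gamma> {1..n} = \<gamma> i + sum \<gamma> ({1..n} - {i})" for \<gamma> :: "nat \<Rightarrow> nat"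
    using i by (intro sum.remove) auto
  have upd: "sum (\<gamma>(i := k)) ({1..n} - {i}) = sum \<gamma> ({1..n} - {i})" for \<gamma> :: "nat \<Rightarrow> nat" and k
    by (intro sum.cong) auto
  have "(\<Sum>\<gamma>\<in>multi_indices n N. f (\<gamma>(i := Suc (\<gamma> i))))
      = (\<Sum>\<gamma>\<in>{\<gamma> \<in> multi_indices n (Suc N). \<gamma> i \<noteq> 0}. f \<gamma>)"
  proof (rule sum.reindex_bij_witness[where i = "\<lambda>\<gamma>. \<gamma>(i := \<gamma> i - 1)"
        and j = "\<lambda>\<gamma>. \<gamma>(i := Suc (\<gamma> i))"])
    fix \<gamma> assume "\<gamma> \<in> multi_indices n N"
    then show "\<gamma>(i := Suc (\<gamma> i)) \<in> {\<gamma> \<in> multi_indices n (Suc N). \<gamma> i \<noteq> 0}"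
      using i split[of \<gamma>] split[of "\<gamma>(i := Suc (\<gamma> i))"]
      by (auto simp: multi_indices_def upd PiE_iff extensional_def)
  next
    fix \<gamma> assume "\<gamma> \<in> {\<gamma> \<in> multi_indices n (Suc N). \<gamma> i \<noteq> 0}"
    then show "\<gamma>(i := \<gamma> i - 1) \<in> multi_indices n N"
      using i split[of \<gamma>] split[of "\<gamma>(i := \<gamma> i - 1)"]
      by (auto simp: multi_indices_def upd PiE_iff extensional_def)
  qed auto
  also have "\<dots> = (\<Sum>\<gamma>\<in>multi_indices n (Suc N). f \<gamma>)"
    by (rule sum.mono_neutral_left) (auto simp: finite_multi_indices f0)
  finally show ?thesis .
qed

definition box_weight :: "complex \<Rightarrow> nat \<Rightarrow> (nat \<Rightarrow> complex) \<Rightarrow> (nat \<Rightarrow> nat) \<Rightarrow> complex" where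
  "box_weight q n x \<gamma> = Delta n (\<lambda>i. x i * q ^ \<gamma> i) / Delta n x
    / (\<Prod>i\<in>{1..n}. \<Prod>j\<in>{1..n}. qpoch q (q * x i / x j) (\<gamma> i))"

text \<open>The notion isolates what the recursions use: numerator and denominator parameters enter only through
a single function \<open>h\<close> evaluated at the contents \<open>x i * q ^ s\<close> of the boxes.\<close>

definition box_sum ::
  "complex \<Rightarrow> nat \<Rightarrow> nat \<Rightarrow> (nat \<Rightarrow> complex) \<Rightarrow> (complex \<Rightarrow> complex) \<Rightarrow> complex" where
  "box_sum q n N x h =
    (\<Sum>\<gamma>\<in>multi_indices n N. box_weight q n x \<gamma> * (\<Prod>i\<in>{1..n}. \<Prod>s<\<gamma> i. h (x i * q ^ s)))"

text \<open>The effect on the weight of a new last box in row \<open>i\<close>. The factor after \<open>box_weight q n x \<gamma>'\<close> is the one whose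
sum over \<open>i\<close> equals \<open>1 - q ^ (N + 1)\<close> by partial fractions with poles \<open>X \<gamma>' l\<close>, and it cancels the
denominators \<open>qpoch q (q * x i / x l)\<close> of the new box. What remains is the residue factor of the
smaller diagram, with poles \<open>X \<gamma> l\<close>.\<close>

lemma box_weight_add_box:
  fixes x :: "nat \<Rightarrow> complex"
  assumes sep: "separated q n (Suc N) x" and "q \<noteq> 0" and \<gamma>: "\<gamma> \<in> multi_indices n N"
    and i: "i \<in> {1..n}"
  defines "X \<equiv> \<lambda>\<gamma> l. x l * q ^ \<gamma> l" and "\<gamma>' \<equiv> \<gamma>(i := Suc (\<gamma> i))"
  shows "box_weight q n x \<gamma>' * ((\<Prod>l\<in>{1..n}. 1 - X \<gamma>' i / x l) / (\<Prod>l\<in>{1..n} - {i}. 1 - X \<gamma>' i / X \<gamma>' l))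
    = box_weight q n x \<gamma> / (\<Prod>l\<in>{1..n} - {i}. 1 - X \<gamma> i / X \<gamma> l)"
proof -
  let ?O = "{1..n} - {i}"
  have split: "(\<Prod>k\<in>{1..n}. f k) = f i * (\<Prod>k\<in>?O. f k)" for f :: "nat \<Rightarrow> complex"
    using i by (intro prod.remove) auto
  note le = multi_indices_le[OF \<gamma>]
  have Xnz: "X \<gamma> l \<noteq> 0" if "l \<in> {1..n}" for l
    using separated_nonzero[OF sep that] \<open>q \<noteq> 0\<close> by (simp add: X_def)
  have neq: "X \<gamma> i \<noteq> X \<gamma> l" "q * X \<gamma> i \<noteq> X \<gamma> l" if "l \<in> ?O" for l
    using separated_power_eq[OF sep i, of l "\<gamma> i" "\<gamma> l"]
      separated_power_eq[OF sep i, of l "Suc (\<gamma> i)" "\<gamma> l"] le[of l] le[OF i] that \<open>q \<noteq> 0\<close>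
    by (auto simp: X_def mult_ac)
  have X': "X \<gamma>' = (X \<gamma>)(i := q * X \<gamma> i)"
    by (auto simp: X_def \<gamma>'_def mult_ac)
  have Xi: "X \<gamma>' i = q * X \<gamma> i" and Xl: "X \<gamma>' l = X \<gamma> l" if "l \<in> ?O" for l
    using that by (auto simp: X')
  have den: "(\<Prod>k\<in>{1..n}. \<Prod>j\<in>{1..n}. qpoch q (q * x k / x j) (\<gamma>' k))
      = (\<Prod>k\<in>{1..n}. \<Prod>j\<in>{1..n}. qpoch q (q * x k / x j) (\<gamma> k)) * (\<Prod>l\<in>{1..n}. 1 - X \<gamma>' i / x l)"
    (is "?Q' = ?Q * ?R")
    unfolding split[of "\<lambda>k. \<Prod>j\<in>{1..n}. qpoch q (q * x k / x j) (_ k)"]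
    by (simp add: \<gamma>'_def qpoch_Suc prod.distrib X_def mult_ac)
  have R: "?R \<noteq> 0"
  proof -
    have "X \<gamma>' i \<noteq> x l" if "l \<in> {1..n}" for l
      using separated_power_eq[OF sep i that, of "Suc (\<gamma> i)" 0] le[OF i] \<open>q \<noteq> 0\<close>
      by (auto simp: X_def \<gamma>'_def mult_ac)
    then show ?thesis using separated_nonzero[OF sep] by simp
  qed
  have Delta: "Delta n (X \<gamma>') * (\<Prod>l\<in>?O. X \<gamma> i - X \<gamma> l)
      = Delta n (X \<gamma>) * (\<Prod>l\<in>?O. q * X \<gamma> i - X \<gamma> l)"
    unfolding X' by (rule Delta_fun_upd[OF i])
  have nz: "(\<Prod>l\<in>?O. X \<gamma> i - X \<gamma> l) \<noteq> 0" "(\<Prod>l\<in>?O. q * X \<gamma> i - X \<gamma> l) \<noteq> 0"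
    using neq by auto
  have c1: "(\<Prod>l\<in>?O. 1 - X \<gamma> i / X \<gamma> l) = (\<Prod>l\<in>?O. X \<gamma> i - X \<gamma> l) * (\<Prod>l\<in>?O. - 1 / X \<gamma> l)"
    unfolding prod.distrib[symmetric] using Xnz by (intro prod.cong) (auto simp: field_simps)
  have c2: "(\<Prod>l\<in>?O. 1 - X \<gamma>' i / X \<gamma>' l) = (\<Prod>l\<in>?O. q * X \<gamma> i - X \<gamma> l) * (\<Prod>l\<in>?O. - 1 / X \<gamma> l)"
    unfolding prod.distrib[symmetric] using Xnz
    by (intro prod.cong) (auto simp: Xl Xi field_simps X')
  have nz3: "(\<Prod>l\<in>?O. - 1 / X \<gamma> l) \<noteq> 0" using Xnz by auto
  have w': "box_weight q n x \<gamma>' = Delta n (X \<gamma>') / Delta n x / (?Q * ?R)"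
    unfolding box_weight_def den[symmetric] by (simp add: X_def)
  have w: "box_weight q n x \<gamma> = Delta n (X \<gamma>) / Delta n x / ?Q"
    unfolding box_weight_def by (simp add: X_def)
  have ratio: "Delta n (X \<gamma>') / (\<Prod>l\<in>?O. q * X \<gamma> i - X \<gamma> l) = Delta n (X \<gamma>) / (\<Prod>l\<in>?O. X \<gamma> i - X \<gamma> l)"
    using Delta nz by (simp add: frac_eq_eq)
  have cancel: "M' / d / (Q * R) * (R / (s' * g)) = M / d / Q / (s * g)"
    if "M' / s' = M / s" "R \<noteq> 0" for M' M d Q R s s' g :: complex
    using arg_cong[OF that(1), of "\<lambda>z. z / (d * Q * g)"] that(2) by (simp add: mult_ac)
  show ?thesis
    unfolding w w' c1 c2 by (rule cancel[OF ratio R])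
qed

text \<open>The effect on the weight of deleting the first box of row \<open>i\<close>: the other boxes of the row keep their
contents when the row is started at \<open>q * x i\<close>, so the Vandermonde numerator does not change. The shifted
factorials in \<open>x i / x l\<close> lose their first factor, and those in \<open>x l / x i\<close> exchange their last factor for
a new first one.\<close>

lemma box_weight_shift:
  fixes x :: "nat \<Rightarrow> complex"
  assumes sep: "separated q n (Suc N) x" and "q \<noteq> 0" and \<gamma>: "\<gamma> \<in> multi_indices n N"
    and i: "i \<in> {1..n}"
  defines "\<gamma>' \<equiv> \<gamma>(i := Suc (\<gamma> i))"
  shows "box_weight q n x \<gamma>' * ((1 - q ^ \<gamma>' i) * (\<Prod>l\<in>{1..n} - {i}. 1 - q ^ \<gamma>' l * x l / x i))
    = box_weight q n (x(i := q * x i)) \<gamma> * (\<Prod>l\<in>{1..n} - {i}. - x l / x i)"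
proof -
  let ?O = "{1..n} - {i}" and ?x = "x(i := q * x i)"
  have split: "(\<Prod>k\<in>{1..n}. f k) = f i * (\<Prod>k\<in>?O. f k)" for f :: "nat \<Rightarrow> complex"
    using i by (intro prod.remove) auto
  have split2: "(\<Prod>k\<in>{1..n}. \<Prod>j\<in>{1..n}. f k j)
      = f i i * (\<Prod>j\<in>?O. f i j) * (\<Prod>k\<in>?O. f k i) * (\<Prod>k\<in>?O. \<Prod>j\<in>?O. f k j)"
    for f :: "nat \<Rightarrow> nat \<Rightarrow> complex"
  proof -
    have "(\<Prod>k\<in>{1..n}. \<Prod>j\<in>{1..n}. f k j) = (\<Prod>k\<in>{1..n}. f k i * (\<Prod>j\<in>?O. f k j))"
      by (rule prod.cong[OF refl split])
    also have "\<dots> = f i i * (\<Prod>j\<in>?O. f i j) * (\<Prod>k\<in>?O. f k i) * (\<Prod>k\<in>?O. \<Prod>j\<in>?O. f k j)"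
      by (subst split) (simp only: prod.distrib mult_ac)
    finally show ?thesis .
  qed
  note le = multi_indices_le[OF \<gamma>]
  have xnz: "x l \<noteq> 0" if "l \<in> {1..n}" for l
    using separated_nonzero[OF sep that] .
  have neq: "x i \<noteq> x l" "q * x i \<noteq> x l" "x l * q ^ \<gamma> l \<noteq> x i" if "l \<in> ?O" for l
    using separated_power_eq[OF sep i, of l 0 0] separated_power_eq[OF sep i, of l 1 0]
      separated_power_eq[OF sep i, of l 0 "\<gamma> l"] le[of l] that \<open>q \<noteq> 0\<close>
    by (auto simp: mult_ac)
  have qi: "q * q ^ \<gamma> i \<noteq> 1"
    using separated_power_eq[OF sep i i, of "Suc (\<gamma> i)" 0] le[OF i] \<open>q \<noteq> 0\<close> by auto
  let ?Q' = "\<Prod>k\<in>{1..n}. \<Prod>j\<in>{1..n}. qpoch q (q * x k / x j) (\<gamma>' k)"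
  let ?Q = "\<Prod>k\<in>{1..n}. \<Prod>j\<in>{1..n}. qpoch q (q * ?x k / ?x j) (\<gamma> k)"
  let ?a = "\<Prod>l\<in>?O. 1 - q * x i / x l" and ?b = "\<Prod>l\<in>?O. 1 - x l / x i"
    and ?c = "\<Prod>l\<in>?O. 1 - q ^ \<gamma>' l * x l / x i"
  have den: "?Q' * ?b = ?Q * ((1 - q ^ \<gamma>' i) * ?a * ?c)"
  proof -
    have d: "qpoch q (q * x i / x i) (\<gamma>' i) = qpoch q (q * ?x i / ?x i) (\<gamma> i) * (1 - q ^ \<gamma>' i)"
      using xnz[OF i] \<open>q \<noteq> 0\<close> by (simp add: \<gamma>'_def qpoch_Suc)
    have r: "(\<Prod>l\<in>?O. qpoch q (q * x i / x l) (\<gamma>' i)) = (\<Prod>l\<in>?O. qpoch q (q * ?x i / ?x l) (\<gamma> i)) * ?a"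
      unfolding prod.distrib[symmetric]
      by (intro prod.cong) (auto simp: \<gamma>'_def qpoch_Suc' mult_ac)
    have c: "(\<Prod>k\<in>?O. qpoch q (q * x k / x i) (\<gamma>' k)) * ?b
        = (\<Prod>k\<in>?O. qpoch q (q * ?x k / ?x i) (\<gamma> k)) * ?c"
      unfolding prod.distrib[symmetric]
    proof (intro prod.cong refl)
      fix k assume "k \<in> ?O"
      then show "qpoch q (q * x k / x i) (\<gamma>' k) * (1 - x k / x i)
          = qpoch q (q * ?x k / ?x i) (\<gamma> k) * (1 - q ^ \<gamma>' k * x k / x i)"
        using qpoch_shift[of q "x k / x i" "\<gamma> k"] \<open>q \<noteq> 0\<close> by (auto simp: \<gamma>'_def mult_ac)
    qed
    have o: "(\<Prod>k\<in>?O. \<Prod>j\<in>?O. qpoch q (q * x k / x j) (\<gamma>' k))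
        = (\<Prod>k\<in>?O. \<Prod>j\<in>?O. qpoch q (q * ?x k / ?x j) (\<gamma> k))"
      by (intro prod.cong) (auto simp: \<gamma>'_def)
    show ?thesis unfolding split2 d r o using c by (simp add: mult_ac)
  qed
  have nz: "?a \<noteq> 0" "?b \<noteq> 0" "?c \<noteq> 0" "1 - q ^ \<gamma>' i \<noteq> 0"
    using neq neq(2,3)[THEN not_sym] xnz i qi by (auto simp: \<gamma>'_def field_simps)
  have Delta: "Delta n ?x * (\<Prod>l\<in>?O. x i - x l) = Delta n x * (\<Prod>l\<in>?O. q * x i - x l)"
    by (rule Delta_fun_upd[OF i])
  have a: "(\<Prod>l\<in>?O. q * x i - x l) = ?a * (\<Prod>l\<in>?O. - x l)"
    unfolding prod.distrib[symmetric] using xnz by (intro prod.cong) (auto simp: field_simps)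
  have b: "(\<Prod>l\<in>?O. x i - x l) * (\<Prod>l\<in>?O. - x l / x i) = ?b * (\<Prod>l\<in>?O. - x l)"
    unfolding prod.distrib[symmetric] using xnz[OF i] by (intro prod.cong) (auto simp: field_simps)
  have nzx: "(\<Prod>l\<in>?O. - x l) \<noteq> 0" "(\<Prod>l\<in>?O. - x l / x i) \<noteq> 0" using xnz i by auto
  have same: "(\<lambda>k. x k * q ^ \<gamma>' k) = (\<lambda>k. ?x k * q ^ \<gamma> k)"
    by (auto simp: \<gamma>'_def)
  have D: "Delta n ?x * ?b = Delta n x * ?a * (\<Prod>l\<in>?O. - x l / x i)"
  proof -
    have "(Delta n ?x * ?b) * (\<Prod>l\<in>?O. - x l) = (Delta n x * ?a * (\<Prod>l\<in>?O. - x l / x i)) * (\<Prod>l\<in>?O. - x l)"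
      using arg_cong[OF Delta, of "\<lambda>z. z * (\<Prod>l\<in>?O. - x l / x i)"]
      unfolding a mult.assoc b by (simp add: mult_ac)
    then show ?thesis using nzx by simp
  qed
  have Q': "?Q' = ?Q * ((1 - q ^ \<gamma>' i) * ?a * ?c) / ?b"
    using den nz by (simp add: field_simps)
  have Dx: "Delta n ?x = Delta n x * ?a * (\<Prod>l\<in>?O. - x l / x i) / ?b"
    using D nz by (simp add: field_simps)
  define M where "M = Delta n (\<lambda>k. ?x k * q ^ \<gamma> k)"
  have w': "box_weight q n x \<gamma>' = M / Delta n x / (?Q * ((1 - q ^ \<gamma>' i) * ?a * ?c) / ?b)"
    unfolding box_weight_def same Q'[symmetric] M_def ..
  have w: "box_weight q n ?x \<gamma> = M / (Delta n x * ?a * (\<Prod>l\<in>?O. - x l / x i) / ?b) / ?Q"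
    unfolding box_weight_def Dx[symmetric] M_def ..
  have cancel: "M / d / (Q * (s * a * c) / b) * (s * c) = M / (d * a * r / b) / Q * r"
    if "s \<noteq> 0" "a \<noteq> 0" "c \<noteq> 0" "b \<noteq> 0" "r \<noteq> 0" for d Q s a c b r :: complex
    using that by (simp add: divide_simps)
  show ?thesis
    unfolding w w' by (rule cancel[OF nz(4,1,3,2) nzx(2)])
qed

text \<open>Each diagram is weighted by \<open>(\<Sum>i. r i \<gamma>) = 1 - q ^ (N + 1)\<close>, where the summand \<open>r i \<gamma>\<close> vanishes on
diagrams with empty row \<open>i\<close>. In the \<open>i\<close>-th part the first box of row \<open>i\<close> is deleted.\<close>

lemma box_sum_recursion:
  assumes sep: "separated q n (Suc N) x" and "q \<noteq> 0"
  shows "(1 - q ^ Suc N) * box_sum q n (Suc N) x h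
    = (\<Sum>i\<in>{1..n}. h (x i) / (\<Prod>l\<in>{1..n} - {i}. 1 - x i / x l) * box_sum q n N (x(i := q * x i)) h)"
proof -
  let ?I = "{1..n}"
  have xnz: "x l \<noteq> 0" if "l \<in> ?I" for l
    using separated_nonzero[OF sep that] .
  have xneq: "x i \<noteq> x l" if "i \<in> ?I" "l \<in> ?I - {i}" for i l
    using separated_power_eq[OF sep that(1), of l 0 0] that \<open>q \<noteq> 0\<close> by auto
  define H where "H x \<gamma> = (\<Prod>i\<in>?I. \<Prod>s<\<gamma> i. h (x i * q ^ s))" for x :: "nat \<Rightarrow> complex" and \<gamma>
  define r where "r i \<gamma> = (1 - q ^ \<gamma> i) * (\<Prod>l\<in>?I - {i}. 1 - q ^ \<gamma> l * x l / x i)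
      / (\<Prod>l\<in>?I - {i}. 1 - x l / x i)" for i and \<gamma> :: "nat \<Rightarrow> nat"
  have r_sum: "(\<Sum>i\<in>?I. r i \<gamma>) = 1 - q ^ Suc N" if "\<gamma> \<in> multi_indices n (Suc N)" for \<gamma>
  proof -
    \<comment> \<open>The poles are the reciprocals of the \<open>x j\<close>, the zeros the reciprocals of the \<open>q ^ \<gamma> l * x l\<close>.\<close>
    have total: "(\<Sum>j\<in>?I. (\<Prod>l\<in>?I. 1 - (q ^ \<gamma> l * x l) * (1 / x j)) / (\<Prod>l\<in>?I - {j}. 1 - (1 / x j) / (1 / x l)))
        = 1 - (\<Prod>j\<in>?I. q ^ \<gamma> j * x j * (1 / x j))"
    proof (rule partial_fractions)
      show "inj_on (\<lambda>j. 1 / x j) ?I"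
        by (rule inj_onI) (use xneq in \<open>fastforce simp: inverse_eq_divide[symmetric]\<close>)
    qed (use xnz in auto)
    have power: "(\<Prod>j\<in>?I. q ^ \<gamma> j * x j * (1 / x j)) = q ^ Suc N"
    proof -
      have "(\<Prod>j\<in>?I. q ^ \<gamma> j * x j * (1 / x j)) = (\<Prod>j\<in>?I. q ^ \<gamma> j)"
        using xnz by (intro prod.cong) auto
      then show ?thesis using that by (simp add: multi_indices_def flip: power_sum)
    qed
    have summand: "(\<Prod>l\<in>?I. 1 - (q ^ \<gamma> l * x l) * (1 / x j)) / (\<Prod>l\<in>?I - {j}. 1 - (1 / x j) / (1 / x l)) = r j \<gamma>"
      if "j \<in> ?I" for j
    proof -
      have "(\<Prod>l\<in>?I. 1 - (q ^ \<gamma> l * x l) * (1 / x j))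
          = (1 - (q ^ \<gamma> j * x j) * (1 / x j)) * (\<Prod>l\<in>?I - {j}. 1 - (q ^ \<gamma> l * x l) * (1 / x j))"
        using that by (intro prod.remove) auto
      then show ?thesis using xnz[OF that] by (simp add: r_def)
    qed
    show ?thesis
      by (rule trans[OF sum.cong[OF refl summand[symmetric]] total[unfolded power]])
  qed
  have step: "box_weight q n x (\<gamma>(i := Suc (\<gamma> i))) * H x (\<gamma>(i := Suc (\<gamma> i))) * r i (\<gamma>(i := Suc (\<gamma> i)))
      = h (x i) / (\<Prod>l\<in>?I - {i}. 1 - x i / x l) * (box_weight q n (x(i := q * x i)) \<gamma> * H (x(i := q * x i)) \<gamma>)"
    if i: "i \<in> ?I" and \<gamma>: "\<gamma> \<in> multi_indices n N" for i \<gamma>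
  proof -
    let ?\<gamma> = "\<gamma>(i := Suc (\<gamma> i))" and ?x = "x(i := q * x i)" and ?O = "?I - {i}"
    have split: "(\<Prod>k\<in>?I. f k) = f i * (\<Prod>k\<in>?O. f k)" for f :: "nat \<Rightarrow> complex"
      using i by (intro prod.remove) auto
    have O: "(\<Prod>k\<in>?O. \<Prod>s<?\<gamma> k. h (x k * q ^ s)) = (\<Prod>k\<in>?O. \<Prod>s<\<gamma> k. h (?x k * q ^ s))"
      by (intro prod.cong) auto
    have first: "(\<Prod>s<?\<gamma> i. h (x i * q ^ s)) = h (x i) * (\<Prod>s<\<gamma> i. h (?x i * q ^ s))"
      by (simp add: prod.lessThan_Suc_shift mult_ac del: prod.lessThan_Suc)
    have H: "H x ?\<gamma> = h (x i) * H ?x \<gamma>"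
      unfolding H_def split O first by (simp only: mult_ac)
    have flip: "(\<Prod>l\<in>?O. 1 - x l / x i) = (\<Prod>l\<in>?O. 1 - x i / x l) * (\<Prod>l\<in>?O. - x l / x i)"
      unfolding prod.distrib[symmetric] using xnz i by (intro prod.cong) (auto simp: field_simps)
    have nz: "(\<Prod>l\<in>?O. - x l / x i) \<noteq> 0" using xnz i by auto
    have cancel: "W * (h * Y) * (a * b / (g * c)) = h / g * (V * Y)"
      if "W * (a * b) = V * c" "c \<noteq> 0" for W Y a b c g h V :: complex
      using arg_cong[OF that(1), of "\<lambda>z. z * (h * Y / g / c)"] that(2) by (simp add: mult_ac)
    show ?thesis
      unfolding H r_def flip
      by (rule cancel[OF box_weight_shift[OF sep \<open>q \<noteq> 0\<close> \<gamma> i] nz])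
  qed
  have "(1 - q ^ Suc N) * box_sum q n (Suc N) x h
      = (\<Sum>\<gamma>\<in>multi_indices n (Suc N). \<Sum>i\<in>?I. box_weight q n x \<gamma> * H x \<gamma> * r i \<gamma>)"
    unfolding box_sum_def H_def[symmetric] sum_distrib_left
    by (intro sum.cong refl) (simp only: sum_distrib_left[symmetric] r_sum, simp only: mult_ac)
  also have "\<dots> = (\<Sum>i\<in>?I. \<Sum>\<gamma>\<in>multi_indices n (Suc N). box_weight q n x \<gamma> * H x \<gamma> * r i \<gamma>)"
    by (rule sum.swap)
  also have "\<dots> = (\<Sum>i\<in>?I. \<Sum>\<gamma>\<in>multi_indices n N.
      h (x i) / (\<Prod>l\<in>?I - {i}. 1 - x i / x l) * (box_weight q n (x(i := q * x i)) \<gamma> * H (x(i := q * x i)) \<gamma>))"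
  proof (rule sum.cong[OF refl])
    fix i assume i: "i \<in> ?I"
    have "(\<Sum>\<gamma>\<in>multi_indices n (Suc N). box_weight q n x \<gamma> * H x \<gamma> * r i \<gamma>)
      = (\<Sum>\<gamma>\<in>multi_indices n N. box_weight q n x (\<gamma>(i := Suc (\<gamma> i)))
          * H x (\<gamma>(i := Suc (\<gamma> i))) * r i (\<gamma>(i := Suc (\<gamma> i))))"
      by (rule sum_multi_indices_add_box[OF i, symmetric,
            where f = "\<lambda>\<gamma>. box_weight q n x \<gamma> * H x \<gamma> * r i \<gamma>"]) (simp add: r_def)
    also have "\<dots> = (\<Sum>\<gamma>\<in>multi_indices n N. h (x i) / (\<Prod>l\<in>?I - {i}. 1 - x i / x l)
          * (box_weight q n (x(i := q * x i)) \<gamma> * H (x(i := q * x i)) \<gamma>))"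
      by (intro sum.cong refl step i)
    finally show "(\<Sum>\<gamma>\<in>multi_indices n (Suc N). box_weight q n x \<gamma> * H x \<gamma> * r i \<gamma>)
      = (\<Sum>\<gamma>\<in>multi_indices n N. h (x i) / (\<Prod>l\<in>?I - {i}. 1 - x i / x l)
          * (box_weight q n (x(i := q * x i)) \<gamma> * H (x(i := q * x i)) \<gamma>))" .
  qed
  also have "\<dots> = (\<Sum>i\<in>?I. h (x i) / (\<Prod>l\<in>?I - {i}. 1 - x i / x l) * box_sum q n N (x(i := q * x i)) h)"
    unfolding box_sum_def H_def sum_distrib_left ..
  finally show ?thesis .
qed

section \<open>The recursion for the dual sum\<close>

text \<open>Both sides of the Euler transformation are built from functions of this shape. Up to the constant \<open>\<kappa>\<close>, the dual
function, with parameters \<open>1 / v\<close>, \<open>1 / p\<close> and \<open>x\<close>, has at \<open>z\<close> the value of \<open>ratio_fn n m p v w (1 / z)\<close>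
multiplied by the factors \<open>1 / (1 - 1 / (z * x j))\<close> and \<open>1 - z / w k\<close>. The inversion \<open>z \<mapsto> 1 / z\<close> exchanges the two
families of poles.\<close>

definition ratio_fn :: "nat \<Rightarrow> nat \<Rightarrow> (nat \<Rightarrow> complex) \<Rightarrow> (nat \<Rightarrow> complex) \<Rightarrow> (nat \<Rightarrow> complex) \<Rightarrow> complex \<Rightarrow> complex" where
  "ratio_fn n m p v w z = (\<Prod>j\<in>{1..n}. 1 - p j * z) * (\<Prod>k\<in>{1..m}. (1 - v k * z) / (1 - w k * z))"

text \<open>Partial fractions for \<open>(\<Prod>j. (1 - p j * z) / (1 - z / x j)) * (\<Prod>k. (1 - v k * z) / (1 - w k * z))\<close>, with
the poles \<open>x i\<close> on the left and the poles \<open>1 / w k\<close> on the right-hand side. The residues at the latter are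
rewritten in the variable \<open>1 / z\<close>: extracting from each linear factor its leading coefficient produces
the value at infinity as a common factor and leaves the dual function at \<open>w k\<close>.\<close>

lemma two_family_partial_fractions:
  fixes x w p v :: "nat \<Rightarrow> complex"
  assumes xnz: "\<And>i. i \<in> {1..n} \<Longrightarrow> x i \<noteq> 0" and wnz: "\<And>k. k \<in> {1..m} \<Longrightarrow> w k \<noteq> 0"
    and xinj: "inj_on x {1..n}" and winj: "inj_on w {1..m}"
    and xw: "\<And>i k. i \<in> {1..n} \<Longrightarrow> k \<in> {1..m} \<Longrightarrow> x i * w k \<noteq> 1"
    and pnz: "\<And>i. i \<in> {1..n} \<Longrightarrow> p i \<noteq> 0" and vnz: "\<And>k. k \<in> {1..m} \<Longrightarrow> v k \<noteq> 0"
  shows "(\<Sum>i\<in>{1..n}. ratio_fn n m p v w (x i) / (\<Prod>l\<in>{1..n} - {i}. 1 - x i / x l))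
    = 1 - (\<Prod>j\<in>{1..n}. p j * x j) * (\<Prod>k\<in>{1..m}. v k / w k)
    + (\<Prod>j\<in>{1..n}. p j * x j) * (\<Prod>k\<in>{1..m}. v k / w k)
      * (\<Sum>k\<in>{1..m}. 1 / (\<Prod>l\<in>{1..m} - {k}. 1 - w k / w l) * ((\<Prod>l\<in>{1..m}. 1 - w k / v l) * (\<Prod>j\<in>{1..n}. (1 - w k / p j) / (1 - x j * w k))))"
proof -
  let ?I = "{1..n}" and ?K = "{1..m}"
  define t where "t = case_sum x (\<lambda>k. 1 / w k)"
  define \<beta> where "\<beta> = case_sum p v"
  define F where "F j = (\<Prod>l\<in>?I <+> ?K. 1 - \<beta> l * t j) / (\<Prod>l\<in>(?I <+> ?K) - {j}. 1 - t j / t l)" for j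
  have Plus_prod: "(\<Prod>l\<in>A <+> B. f l) = (\<Prod>l\<in>A. f (Inl l)) * (\<Prod>l\<in>B. f (Inr l))"
    if "finite A" "finite B" for A B :: "nat set" and f :: "nat + nat \<Rightarrow> complex"
    using that by (simp add: prod.Plus)
  have Plus_sum: "(\<Sum>l\<in>?I <+> ?K. F l) = (\<Sum>l\<in>?I. F (Inl l)) + (\<Sum>l\<in>?K. F (Inr l))"
    by (simp add: sum.Plus)
  have total: "(\<Sum>j\<in>?I <+> ?K. F j) = 1 - (\<Prod>j\<in>?I <+> ?K. \<beta> j * t j)"
    unfolding F_def
  proof (rule partial_fractions)
    show "inj_on t (?I <+> ?K)"
    proof (rule inj_onI)
      fix a b assume "a \<in> ?I <+> ?K" "b \<in> ?I <+> ?K" "t a = t b"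
      then show "a = b"
        using xinj winj xw wnz xnz
        by (cases a; cases b) (auto simp: t_def inj_on_eq_iff field_simps)
    qed
  qed (use xnz wnz in \<open>auto simp: t_def\<close>)
  have \<kappa>: "(\<Prod>j\<in>?I <+> ?K. \<beta> j * t j) = (\<Prod>j\<in>?I. p j * x j) * (\<Prod>k\<in>?K. v k / w k)"
    by (simp add: Plus_prod t_def \<beta>_def)
  have FI: "F (Inl i) = ratio_fn n m p v w (x i) / (\<Prod>l\<in>?I - {i}. 1 - x i / x l)" if "i \<in> ?I" for i
  proof -
    have "(?I <+> ?K) - {Inl i} = (?I - {i}) <+> ?K" by auto
    then show ?thesis
      by (simp add: F_def Plus_prod t_def \<beta>_def ratio_fn_def prod_dividef mult_ac)
  qed
  have FK: "F (Inr k) = - ((\<Prod>j\<in>?I. p j * x j) * (\<Prod>k\<in>?K. v k / w k))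
      * (1 / (\<Prod>l\<in>?K - {k}. 1 - w k / w l) * ((\<Prod>l\<in>?K. 1 - w k / v l) * (\<Prod>j\<in>?I. (1 - w k / p j) / (1 - x j * w k))))"
    if k: "k \<in> ?K" for k
  proof -
    let ?O = "?K - {k}"
    have split: "(\<Prod>l\<in>?K. f l) = f k * (\<Prod>l\<in>?O. f l)" for f :: "nat \<Rightarrow> complex"
      using k by (intro prod.remove) auto
    have "(?I <+> ?K) - {Inr k} = ?I <+> ?O" by auto
    then have "F (Inr k) = (\<Prod>j\<in>?I. 1 - p j / w k) * (\<Prod>l\<in>?K. 1 - v l / w k)
        / ((\<Prod>j\<in>?I. 1 - 1 / (w k * x j)) * (\<Prod>l\<in>?O. 1 - w l / w k))"
      by (simp add: F_def Plus_prod t_def \<beta>_def)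
    also have "\<dots> = (\<Prod>j\<in>?I. (1 - p j / w k) / (1 - 1 / (w k * x j)))
        * ((1 - v k / w k) * (\<Prod>l\<in>?O. (1 - v l / w k) / (1 - w l / w k)))"
      by (subst split) (simp add: prod_dividef)
    also have "(\<Prod>j\<in>?I. (1 - p j / w k) / (1 - 1 / (w k * x j)))
        = (\<Prod>j\<in>?I. p j * x j * ((1 - w k / p j) / (1 - x j * w k)))"
    proof (intro prod.cong refl)
      fix j assume j: "j \<in> ?I"
      have "w k * x j - 1 \<noteq> 0" "1 - x j * w k \<noteq> 0" using xw[OF j k] by (auto simp: mult.commute)
      then show "(1 - p j / w k) / (1 - 1 / (w k * x j)) = p j * x j * ((1 - w k / p j) / (1 - x j * w k))"
        using xnz[OF j] wnz[OF k] pnz[OF j] by (simp add: divide_simps) (simp add: algebra_simps)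
    qed
    also have "(\<Prod>l\<in>?O. (1 - v l / w k) / (1 - w l / w k))
        = (\<Prod>l\<in>?O. v l / w l * ((1 - w k / v l) / (1 - w k / w l)))"
    proof (intro prod.cong refl)
      fix l assume l: "l \<in> ?O"
      then have "w k - w l \<noteq> 0" "w l - w k \<noteq> 0" using winj k by (auto simp: inj_on_eq_iff)
      then show "(1 - v l / w k) / (1 - w l / w k) = v l / w l * ((1 - w k / v l) / (1 - w k / w l))"
        using wnz[OF k] wnz[of l] vnz[of l] l by (simp add: divide_simps) (simp add: algebra_simps)
    qed
    also have "1 - v k / w k = - (v k / w k * (1 - w k / v k))"
      using wnz[OF k] vnz[OF k] by (simp add: field_simps)
    finally show ?thesis
      unfolding split prod.distrib prod_dividef by (simp add: mult_ac)
  qed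
  have "(\<Sum>i\<in>?I. ratio_fn n m p v w (x i) / (\<Prod>l\<in>?I - {i}. 1 - x i / x l)) = (\<Sum>i\<in>?I. F (Inl i))"
    by (rule sum.cong[OF refl FI[symmetric]])
  also have "\<dots> = 1 - (\<Prod>j\<in>?I. p j * x j) * (\<Prod>k\<in>?K. v k / w k) - (\<Sum>k\<in>?K. F (Inr k))"
    using total unfolding Plus_sum \<kappa> by (simp add: algebra_simps)
  also have "(\<Sum>k\<in>?K. F (Inr k)) = - ((\<Prod>j\<in>?I. p j * x j) * (\<Prod>k\<in>?K. v k / w k)) * (\<Sum>k\<in>?K.
      1 / (\<Prod>l\<in>?K - {k}. 1 - w k / w l) * ((\<Prod>l\<in>?K. 1 - w k / v l) * (\<Prod>j\<in>?I. (1 - w k / p j) / (1 - x j * w k))))"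
    unfolding sum_distrib_left by (rule sum.cong[OF refl FK])
  finally show ?thesis by simp
qed

text \<open>Replacing \<open>x i\<close> by \<open>q * x i\<close> in the weight of a dual diagram \<open>\<gamma>\<close> telescopes: only the factors
\<open>(1 - w k * x i) / (1 - w k * q ^ \<gamma> k * x i)\<close> remain. Hence the sum over \<open>i\<close> is the sum of the residues at
\<open>z = x i\<close> of a function whose other poles \<open>1 / (w k * q ^ \<gamma> k)\<close> are attached to the places where a box
can be added to \<open>\<gamma>\<close>. The value of this function at infinity is \<open>\<kappa> / q ^ L\<close>. Up to the factor \<open>- \<kappa> / q ^ L\<close>,
the residues at the other poles turn the weight of \<open>\<gamma>\<close> into the weights of the enlarged diagrams, multiplied
by quantities \<open>r k\<close> whose sum for a fixed enlarged diagram is \<open>1 - q ^ (L + 1)\<close>.\<close>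

lemma dual_box_sum_recursion:
  fixes x p v w :: "nat \<Rightarrow> complex"
  assumes "q \<noteq> 0" and xsep: "separated q n 0 x" and wsep: "separated q m (Suc L) w"
    and xw: "\<And>i k s. i \<in> {1..n} \<Longrightarrow> k \<in> {1..m} \<Longrightarrow> s \<le> L \<Longrightarrow> x i * w k * q ^ s \<noteq> 1"
    and pnz: "\<And>i. i \<in> {1..n} \<Longrightarrow> p i \<noteq> 0" and vnz: "\<And>k. k \<in> {1..m} \<Longrightarrow> v k \<noteq> 0"
  defines "\<kappa> \<equiv> (\<Prod>j\<in>{1..n}. p j * x j) * (\<Prod>k\<in>{1..m}. v k / w k)"
    and "G \<equiv> \<lambda>L x. box_sum q m L w (ratio_fn m n (\<lambda>k. 1 / v k) (\<lambda>i. 1 / p i) x)"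
  shows "q ^ L * (\<Sum>i\<in>{1..n}. ratio_fn n m p v w (x i) / (\<Prod>l\<in>{1..n} - {i}. 1 - x i / x l) * G L (x(i := q * x i)))
    = (q ^ L - \<kappa>) * G L x + (1 - q ^ Suc L) * \<kappa> * G (Suc L) x"
proof -
  let ?I = "{1..n}" and ?K = "{1..m}"
  define h where "h x = ratio_fn m n (\<lambda>k. 1 / v k) (\<lambda>i. 1 / p i) x" for x
  define H where "H x \<gamma> = (\<Prod>k\<in>?K. \<Prod>s<\<gamma> k. h x (w k * q ^ s))" for x :: "nat \<Rightarrow> complex" and \<gamma>
  define T where "T x \<gamma> = box_weight q m w \<gamma> * H x \<gamma>" for x \<gamma>
  define W where "W \<gamma> k = w k * q ^ \<gamma> k" for \<gamma> :: "nat \<Rightarrow> nat" and k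
  define C where "C i = ratio_fn n m p v w (x i) / (\<Prod>l\<in>?I - {i}. 1 - x i / x l)" for i
  define r where "r k \<gamma> = (\<Prod>l\<in>?K. 1 - W \<gamma> k / w l) / (\<Prod>l\<in>?K - {k}. 1 - W \<gamma> k / W \<gamma> l)"
    for k \<gamma>
  have xnz: "x i \<noteq> 0" if "i \<in> ?I" for i using separated_nonzero[OF xsep that] .
  have wnz: "w k \<noteq> 0" if "k \<in> ?K" for k using separated_nonzero[OF wsep that] .
  have xinj: "inj_on x ?I" using separated_Delta[OF xsep] by (simp add: Delta_nonzero_iff)
  have Wnz: "W \<gamma> k \<noteq> 0" if "k \<in> ?K" for \<gamma> k using wnz[OF that] \<open>q \<noteq> 0\<close> by (simp add: W_def)
  have Winj: "inj_on (W \<gamma>) ?K" if "\<gamma> \<in> multi_indices m M" "M \<le> Suc L" for \<gamma> M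
  proof (rule inj_onI)
    fix k l assume "k \<in> ?K" "l \<in> ?K" "W \<gamma> k = W \<gamma> l"
    then show "k = l"
      using separated_power_eq[OF wsep, of k l "\<gamma> k" "\<gamma> l"] multi_indices_le[OF that(1)] that(2) \<open>q \<noteq> 0\<close>
      unfolding W_def by (meson order_trans)
  qed
  have W_prod: "(\<Prod>k\<in>?K. W \<gamma> k) = (\<Prod>k\<in>?K. w k) * q ^ M" if "\<gamma> \<in> multi_indices m M" for \<gamma> M
    using that by (simp add: W_def prod.distrib multi_indices_def flip: power_sum)
  have r_sum: "(\<Sum>k\<in>?K. r k \<gamma>) = 1 - q ^ Suc L" if \<gamma>: "\<gamma> \<in> multi_indices m (Suc L)" for \<gamma>
  proof -
    have "(\<Sum>k\<in>?K. (\<Prod>l\<in>?K. 1 - 1 / w l * W \<gamma> k) / (\<Prod>l\<in>?K - {k}. 1 - W \<gamma> k / W \<gamma> l))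
        = 1 - (\<Prod>k\<in>?K. 1 / w k * W \<gamma> k)"
      by (rule partial_fractions) (use Wnz Winj[OF \<gamma>] in auto)
    moreover have "(\<Prod>k\<in>?K. 1 / w k * W \<gamma> k) = q ^ Suc L"
      using wnz unfolding prod.distrib W_prod[OF \<gamma>] by (simp add: prod_dividef)
    ultimately show ?thesis by (simp add: r_def)
  qed
  have shifted: "C i * T (x(i := q * x i)) \<gamma>
      = T x \<gamma> * (ratio_fn n m p v (W \<gamma>) (x i) / (\<Prod>l\<in>?I - {i}. 1 - x i / x l))"
    if i: "i \<in> ?I" and \<gamma>: "\<gamma> \<in> multi_indices m L" for i \<gamma>
  proof -
    let ?x = "x(i := q * x i)" and ?O = "?I - {i}"
    have split: "(\<Prod>k\<in>?I. f k) = f i * (\<Prod>k\<in>?O. f k)" for f :: "nat \<Rightarrow> complex"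
      using i by (intro prod.remove) auto
    \<comment> \<open>The telescoping within row \<open>k\<close>, by induction on its number \<open>g\<close> of boxes.\<close>
    have one: "(\<Prod>s<g. h ?x (w k * q ^ s)) * (1 - W' * x i) = (\<Prod>s<g. h x (w k * q ^ s)) * (1 - w k * x i)"
      if k: "k \<in> ?K" and g: "g \<le> L" and W': "W' = w k * q ^ g" for k g W'
      using g unfolding W'
    proof (induction g)
      case (Suc g)
      define z where "z = w k * q ^ g"
      define R where "R = (\<Prod>l\<in>?K. 1 - 1 / v l * z) * ((1 - 1 / p i * z) * (\<Prod>j\<in>?O. (1 - 1 / p j * z) / (1 - x j * z)))"
      have O: "(\<Prod>j\<in>?O. (1 - 1 / p j * z) / (1 - ?x j * z)) = (\<Prod>j\<in>?O. (1 - 1 / p j * z) / (1 - x j * z))"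
        by (intro prod.cong) auto
      have h: "h ?x z = R / (1 - q * x i * z)" "h x z = R / (1 - x i * z)"
        unfolding h_def ratio_fn_def R_def split O by auto
      have nz: "1 - q * x i * z \<noteq> 0" "1 - x i * z \<noteq> 0"
        using xw[OF i k, of "Suc g"] xw[OF i k, of g] Suc.prems by (auto simp: z_def mult_ac)
      have cancel: "P * R = P' * (R / b)" if "P * b = P'" "b \<noteq> 0" for P P' b
        unfolding that(1)[symmetric] using that(2) by simp
      have "(\<Prod>s<g. h ?x (w k * q ^ s)) * (1 - x i * z) = (\<Prod>s<g. h x (w k * q ^ s)) * (1 - w k * x i)"
        using Suc by (simp add: z_def mult_ac del: fun_upd_apply)
      then have "(\<Prod>s<g. h ?x (w k * q ^ s)) * R = (\<Prod>s<g. h x (w k * q ^ s)) * (1 - w k * x i) * (R / (1 - x i * z))"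
        by (rule cancel[OF _ nz(2)])
      moreover have "1 - w k * q ^ Suc g * x i = 1 - q * x i * z" by (simp add: z_def)
      moreover have "P * (R / b) * b = P' * (R / b') * c" if "P * R = P' * c * (R / b')" "b \<noteq> 0" for P P' b b' c
        using that by simp
      ultimately show ?case
        unfolding prod.lessThan_Suc z_def[symmetric] h using nz(1) by presburger
    qed simp
    have "H ?x \<gamma> * (\<Prod>k\<in>?K. 1 - W \<gamma> k * x i) = H x \<gamma> * (\<Prod>k\<in>?K. 1 - w k * x i)"
      unfolding H_def prod.distrib[symmetric]
      by (intro prod.cong refl one) (use multi_indices_le[OF \<gamma>] in \<open>auto simp: W_def\<close>)
    moreover have "(\<Prod>k\<in>?K. 1 - W \<gamma> k * x i) \<noteq> 0" "(\<Prod>k\<in>?K. 1 - w k * x i) \<noteq> 0"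
      using xw[OF i] xw[OF i, of _ 0] multi_indices_le[OF \<gamma>] by (auto simp: W_def mult_ac)
    ultimately have "H ?x \<gamma> / (\<Prod>k\<in>?K. 1 - w k * x i) = H x \<gamma> / (\<Prod>k\<in>?K. 1 - W \<gamma> k * x i)"
      by (simp add: field_simps)
    from arg_cong[OF this, of "\<lambda>z. z * (box_weight q m w \<gamma> * (\<Prod>j\<in>?I. 1 - p j * x i)
        * (\<Prod>k\<in>?K. 1 - v k * x i) / (\<Prod>l\<in>?O. 1 - x i / x l))"]
    show ?thesis
      unfolding C_def T_def ratio_fn_def prod_dividef by (simp add: mult_ac)
  qed
  have grow: "T x (\<gamma>(k := Suc (\<gamma> k))) * r k (\<gamma>(k := Suc (\<gamma> k)))
      = T x \<gamma> * (1 / (\<Prod>l\<in>?K - {k}. 1 - W \<gamma> k / W \<gamma> l)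
        * ((\<Prod>l\<in>?K. 1 - W \<gamma> k / v l) * (\<Prod>j\<in>?I. (1 - W \<gamma> k / p j) / (1 - x j * W \<gamma> k))))"
    if k: "k \<in> ?K" and \<gamma>: "\<gamma> \<in> multi_indices m L" for k \<gamma>
  proof -
    let ?\<gamma> = "\<gamma>(k := Suc (\<gamma> k))" and ?O = "?K - {k}"
    have split: "(\<Prod>l\<in>?K. f l) = f k * (\<Prod>l\<in>?O. f l)" for f :: "nat \<Rightarrow> complex"
      using k by (intro prod.remove) auto
    have "(\<Prod>l\<in>?O. \<Prod>s<?\<gamma> l. h x (w l * q ^ s)) = (\<Prod>l\<in>?O. \<Prod>s<\<gamma> l. h x (w l * q ^ s))"
      by (intro prod.cong) auto
    then have H: "H x ?\<gamma> = H x \<gamma> * h x (W \<gamma> k)"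
      unfolding H_def split by (simp add: W_def mult_ac)
    have "box_weight q m w ?\<gamma> * r k ?\<gamma> = box_weight q m w \<gamma> / (\<Prod>l\<in>?O. 1 - W \<gamma> k / W \<gamma> l)"
      using box_weight_add_box[OF wsep \<open>q \<noteq> 0\<close> \<gamma> k] unfolding r_def W_def by blast
    from arg_cong[OF this, of "\<lambda>z. z * (H x \<gamma> * h x (W \<gamma> k))"]
    show ?thesis
      unfolding T_def H by (simp add: h_def ratio_fn_def mult_ac)
  qed
  have expand: "q ^ L * (\<Sum>i\<in>?I. C i * T (x(i := q * x i)) \<gamma>)
      = (q ^ L - \<kappa>) * T x \<gamma> + \<kappa> * (\<Sum>k\<in>?K. T x (\<gamma>(k := Suc (\<gamma> k))) * r k (\<gamma>(k := Suc (\<gamma> k))))"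
    if \<gamma>: "\<gamma> \<in> multi_indices m L" for \<gamma>
  proof -
    have \<kappa>: "(\<Prod>j\<in>?I. p j * x j) * (\<Prod>k\<in>?K. v k / W \<gamma> k) = \<kappa> / q ^ L"
      unfolding \<kappa>_def prod_dividef W_prod[OF \<gamma>] by simp
    have "(\<Sum>i\<in>?I. C i * T (x(i := q * x i)) \<gamma>)
        = T x \<gamma> * (\<Sum>i\<in>?I. ratio_fn n m p v (W \<gamma>) (x i) / (\<Prod>l\<in>?I - {i}. 1 - x i / x l))"
      unfolding sum_distrib_left by (intro sum.cong refl shifted \<gamma>)
    also have "(\<Sum>i\<in>?I. ratio_fn n m p v (W \<gamma>) (x i) / (\<Prod>l\<in>?I - {i}. 1 - x i / x l))
        = 1 - \<kappa> / q ^ L + \<kappa> / q ^ L * (\<Sum>k\<in>?K. 1 / (\<Prod>l\<in>?K - {k}. 1 - W \<gamma> k / W \<gamma> l)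
        * ((\<Prod>l\<in>?K. 1 - W \<gamma> k / v l) * (\<Prod>j\<in>?I. (1 - W \<gamma> k / p j) / (1 - x j * W \<gamma> k))))"
      (is "_ = _ + _ * ?S")
      unfolding \<kappa>[symmetric]
    proof (rule two_family_partial_fractions)
      show "x i * W \<gamma> k \<noteq> 1" if "i \<in> ?I" "k \<in> ?K" for i k
        using xw[OF that multi_indices_le[OF \<gamma> that(2)]] by (simp add: W_def mult_ac)
    qed (use xnz Wnz pnz vnz xinj Winj[OF \<gamma>] in auto)
    finally have sum: "(\<Sum>i\<in>?I. C i * T (x(i := q * x i)) \<gamma>)
        = T x \<gamma> * (1 - \<kappa> / q ^ L + \<kappa> / q ^ L * ?S)" .
    have "q ^ L * (\<Sum>i\<in>?I. C i * T (x(i := q * x i)) \<gamma>)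
        = (q ^ L - \<kappa>) * T x \<gamma> + \<kappa> * (T x \<gamma> * ?S)"
      unfolding sum using \<open>q \<noteq> 0\<close> by (simp add: field_simps)
    also have "T x \<gamma> * ?S = (\<Sum>k\<in>?K. T x (\<gamma>(k := Suc (\<gamma> k))) * r k (\<gamma>(k := Suc (\<gamma> k))))"
      unfolding sum_distrib_left by (intro sum.cong refl grow[symmetric] \<gamma>)
    finally show ?thesis .
  qed
  have G: "G M y = (\<Sum>\<gamma>\<in>multi_indices m M. T y \<gamma>)" for M y
    by (simp add: G_def box_sum_def T_def H_def h_def)
  have "q ^ L * (\<Sum>i\<in>?I. C i * G L (x(i := q * x i)))
      = (\<Sum>\<gamma>\<in>multi_indices m L. q ^ L * (\<Sum>i\<in>?I. C i * T (x(i := q * x i)) \<gamma>))"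
    unfolding G sum_distrib_left by (rule sum.swap)
  also have "\<dots> = (\<Sum>\<gamma>\<in>multi_indices m L. (q ^ L - \<kappa>) * T x \<gamma>
      + \<kappa> * (\<Sum>k\<in>?K. T x (\<gamma>(k := Suc (\<gamma> k))) * r k (\<gamma>(k := Suc (\<gamma> k)))))"
    by (rule sum.cong[OF refl expand])
  also have "\<dots> = (q ^ L - \<kappa>) * G L x
      + \<kappa> * (\<Sum>\<gamma>\<in>multi_indices m L. \<Sum>k\<in>?K. T x (\<gamma>(k := Suc (\<gamma> k))) * r k (\<gamma>(k := Suc (\<gamma> k))))"
    unfolding G sum.distrib sum_distrib_left[symmetric] ..
  also have "(\<Sum>\<gamma>\<in>multi_indices m L. \<Sum>k\<in>?K. T x (\<gamma>(k := Suc (\<gamma> k))) * r k (\<gamma>(k := Suc (\<gamma> k))))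
      = (\<Sum>k\<in>?K. \<Sum>\<gamma>\<in>multi_indices m (Suc L). T x \<gamma> * r k \<gamma>)"
  proof (subst sum.swap, rule sum.cong[OF refl])
    fix k assume k: "k \<in> ?K"
    have "T x \<gamma> * r k \<gamma> = 0" if "\<gamma> k = 0" for \<gamma>
    proof -
      have "(\<Prod>l\<in>?K. 1 - W \<gamma> k / w l) = 0"
        using k wnz[OF k] that by (intro prod_zero) (auto simp: W_def)
      then show ?thesis by (simp add: r_def)
    qed
    then show "(\<Sum>\<gamma>\<in>multi_indices m L. T x (\<gamma>(k := Suc (\<gamma> k))) * r k (\<gamma>(k := Suc (\<gamma> k))))
        = (\<Sum>\<gamma>\<in>multi_indices m (Suc L). T x \<gamma> * r k \<gamma>)"
      by (rule sum_multi_indices_add_box[OF k, where f = "\<lambda>\<gamma>. T x \<gamma> * r k \<gamma>"])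
  qed
  also have "\<dots> = (\<Sum>\<gamma>\<in>multi_indices m (Suc L). T x \<gamma> * (1 - q ^ Suc L))"
    by (subst sum.swap, intro sum.cong refl) (simp only: sum_distrib_left[symmetric] r_sum)
  also have "\<kappa> * \<dots> = (1 - q ^ Suc L) * \<kappa> * G (Suc L) x"
    unfolding G by (simp add: sum_distrib_right[symmetric] mult_ac)
  finally show ?thesis unfolding C_def .
qed

section \<open>The Euler transformation\<close>

lemma box_sum_0:
  assumes "Delta n x \<noteq> 0"
  shows "box_sum q n 0 x h = 1"
proof -
  have "multi_indices n 0 = {\<lambda>i\<in>{1..n}. 0}"
    by (auto simp: multi_indices_def extensional_def fun_eq_iff PiE_iff restrict_def)
  moreover have "Delta n (\<lambda>i. x i * q ^ (\<lambda>i\<in>{1..n}. 0::nat) i) = Delta n x"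
    unfolding Delta_def by (intro prod.cong refl) auto
  ultimately show ?thesis using assms by (simp add: box_sum_def box_weight_def)
qed

text \<open>The coefficient form of \<open>F(u) = R(u) G(\<kappa> u)\<close>. Since \<open>x i\<close> moves in the induction while \<open>p\<close>, \<open>v\<close> and \<open>w\<close>
stay fixed, the zeros of the rational function do not move and \<open>\<kappa>\<close> is multiplied by \<open>q\<close>.\<close>

theorem euler_transformation:
  fixes x p v w :: "nat \<Rightarrow> complex"
  assumes q: "q \<noteq> 0" "\<And>s. s > 0 \<Longrightarrow> q ^ s \<noteq> 1"
    and xsep: "separated q n N x" and wsep: "separated q m N w"
    and xw: "\<And>i k s. i \<in> {1..n} \<Longrightarrow> k \<in> {1..m} \<Longrightarrow> s < N \<Longrightarrow> x i * w k * q ^ s \<noteq> 1"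
    and pnz: "\<And>i. i \<in> {1..n} \<Longrightarrow> p i \<noteq> 0" and vnz: "\<And>k. k \<in> {1..m} \<Longrightarrow> v k \<noteq> 0"
    and \<kappa>: "\<kappa> = (\<Prod>j\<in>{1..n}. p j * x j) * (\<Prod>k\<in>{1..m}. v k / w k)"
  shows "box_sum q n N x (ratio_fn n m p v w)
    = (\<Sum>L=0..N. \<kappa> ^ L * box_sum q m L w (ratio_fn m n (\<lambda>k. 1 / v k) (\<lambda>i. 1 / p i) x)
        * (qpoch q \<kappa> (N - L) / qpoch q q (N - L)))"
  using xsep wsep xw \<kappa>
proof (induction N arbitrary: x \<kappa>)
  case 0
  then show ?case by (simp add: box_sum_0 separated_Delta)
next
  case (Suc N)
  let ?I = "{1..n}" and ?h = "ratio_fn n m p v w"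
  define G where "G L x = box_sum q m L w (ratio_fn m n (\<lambda>k. 1 / v k) (\<lambda>i. 1 / p i) x)" for L x
  define C where "C i = ?h (x i) / (\<Prod>l\<in>?I - {i}. 1 - x i / x l)" for i
  define R where "R \<kappa> k = qpoch q \<kappa> k / qpoch q q k" for \<kappa> k
  have IH: "box_sum q n N (x(i := q * x i)) ?h
      = (\<Sum>L=0..N. (q * \<kappa>) ^ L * G L (x(i := q * x i)) * R (q * \<kappa>) (N - L))" if i: "i \<in> ?I" for i
    unfolding G_def R_def
  proof (rule Suc.IH)
    show "separated q n N (x(i := q * x i))"
      by (rule separated_step[OF Suc.prems(1) q(1)])
    show "separated q m N w" by (rule separated_mono[OF Suc.prems(2)]) simp
    show "(x(i := q * x i)) j * w k * q ^ s \<noteq> 1" if "j \<in> ?I" "k \<in> {1..m}" "s < N" for j k s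
      using Suc.prems(3)[OF that(1,2), of s] Suc.prems(3)[OF that(1,2), of "Suc s"] that
      by (auto simp: mult_ac)
    have "(\<Prod>j\<in>?I. p j * (x(i := q * x i)) j) = q * (\<Prod>j\<in>?I. p j * x j)"
    proof -
      have split: "(\<Prod>k\<in>?I. f k) = f i * (\<Prod>k\<in>?I - {i}. f k)" for f :: "nat \<Rightarrow> complex"
        using i by (intro prod.remove) auto
      have "(\<Prod>j\<in>?I - {i}. p j * (x(i := q * x i)) j) = (\<Prod>j\<in>?I - {i}. p j * x j)"
        by (intro prod.cong) auto
      then show ?thesis unfolding split by (simp add: mult_ac)
    qed
    then show "q * \<kappa> = (\<Prod>j\<in>?I. p j * (x(i := q * x i)) j) * (\<Prod>k\<in>{1..m}. v k / w k)"
      by (simp add: Suc.prems(4) mult_ac)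
  qed
  have dual: "q ^ L * (\<Sum>i\<in>?I. C i * G L (x(i := q * x i)))
      = (q ^ L - \<kappa>) * G L x + (1 - q ^ Suc L) * \<kappa> * G (Suc L) x" if "L \<le> N" for L
    unfolding C_def G_def Suc.prems(4)
  proof (rule dual_box_sum_recursion[OF q(1)])
    show "separated q n 0 x" by (rule separated_mono[OF Suc.prems(1)]) simp
    show "separated q m (Suc L) w" by (rule separated_mono[OF Suc.prems(2)]) (use that in simp)
  qed (use Suc.prems(3) pnz vnz that in auto)
  have Q: "qpoch q q k \<noteq> 0" for k
    using q(2)[of "Suc _"] by (simp add: qpoch_eq_0_iff)
  \<comment> \<open>The two contributions to the coefficient of \<open>G L x\<close> add up to the one in the claim.\<close>
  have coefficient: "R (q * \<kappa>) (N - L) * (q ^ L - \<kappa>) + (1 - q ^ L) * R (q * \<kappa>) (Suc (N - L))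
      = (1 - q ^ Suc N) * R \<kappa> (Suc (N - L))" if "L \<le> N" for L
  proof -
    define M where "M = N - L"
    have N: "q ^ Suc N = q ^ L * q ^ Suc M" using that by (simp add: M_def flip: power_add)
    have nz: "1 - q ^ Suc M \<noteq> 0" using q(2)[of "Suc M"] by simp
    have "R (q * \<kappa>) (Suc M) = R (q * \<kappa>) M * ((1 - \<kappa> * q ^ Suc M) / (1 - q ^ Suc M))"
      by (simp add: R_def qpoch_Suc mult_ac)
    moreover have "R \<kappa> (Suc M) = R (q * \<kappa>) M * ((1 - \<kappa>) / (1 - q ^ Suc M))"
      unfolding R_def qpoch_Suc'[of q \<kappa>] qpoch_Suc[of q q] by (simp add: mult_ac)
    moreover have "(q ^ L - \<kappa>) + (1 - q ^ L) * ((1 - \<kappa> * y) / (1 - y)) = (1 - q ^ L * y) * ((1 - \<kappa>) / (1 - y))"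
      if "1 - y \<noteq> 0" for y
      using that by (simp add: divide_simps) (simp add: algebra_simps)
    from arg_cong[OF this[OF nz], of "\<lambda>z. R (q * \<kappa>) M * z"]
    have "R (q * \<kappa>) M * (q ^ L - \<kappa>) + (1 - q ^ L) * (R (q * \<kappa>) M * ((1 - \<kappa> * q ^ Suc M) / (1 - q ^ Suc M)))
      = (1 - q ^ Suc N) * (R (q * \<kappa>) M * ((1 - \<kappa>) / (1 - q ^ Suc M)))"
      unfolding N by (simp only: distrib_left mult_ac)
    ultimately show ?thesis unfolding M_def[symmetric] by simp
  qed
  have "(1 - q ^ Suc N) * box_sum q n (Suc N) x ?h = (\<Sum>i\<in>?I. C i * box_sum q n N (x(i := q * x i)) ?h)"
    unfolding C_def by (rule box_sum_recursion[OF Suc.prems(1) q(1)])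
  also have "\<dots> = (\<Sum>i\<in>?I. \<Sum>L=0..N. \<kappa> ^ L * R (q * \<kappa>) (N - L) * (q ^ L * (C i * G L (x(i := q * x i)))))"
    by (intro sum.cong refl) (simp add: IH sum_distrib_left power_mult_distrib mult_ac)
  also have "\<dots> = (\<Sum>L=0..N. \<kappa> ^ L * R (q * \<kappa>) (N - L) * (q ^ L * (\<Sum>i\<in>?I. C i * G L (x(i := q * x i)))))"
    unfolding sum_distrib_left by (rule sum.swap)
  also have "\<dots> = (\<Sum>L=0..N. \<kappa> ^ L * G L x * (R (q * \<kappa>) (N - L) * (q ^ L - \<kappa>)))
      + (\<Sum>L=0..N. \<kappa> ^ Suc L * G (Suc L) x * ((1 - q ^ Suc L) * R (q * \<kappa>) (N - L)))"
    unfolding sum.distrib[symmetric]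
  proof (rule sum.cong[OF refl])
    fix L assume "L \<in> {0..N}"
    then have "L \<le> N" by simp
    show "\<kappa> ^ L * R (q * \<kappa>) (N - L) * (q ^ L * (\<Sum>i\<in>?I. C i * G L (x(i := q * x i))))
      = \<kappa> ^ L * G L x * (R (q * \<kappa>) (N - L) * (q ^ L - \<kappa>))
        + \<kappa> ^ Suc L * G (Suc L) x * ((1 - q ^ Suc L) * R (q * \<kappa>) (N - L))"
      unfolding dual[OF \<open>L \<le> N\<close>] by (simp add: distrib_left mult_ac)
  qed
  also have "(\<Sum>L=0..N. \<kappa> ^ Suc L * G (Suc L) x * ((1 - q ^ Suc L) * R (q * \<kappa>) (N - L)))
      = (\<Sum>L=0..Suc N. \<kappa> ^ L * G L x * ((1 - q ^ L) * R (q * \<kappa>) (Suc N - L)))"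
    by (simp add: sum.atLeast0_atMost_Suc_shift del: sum.atLeast0_atMost_Suc sum.cl_ivl_Suc)
  also have "\<dots> = (\<Sum>L=0..N. \<kappa> ^ L * G L x * ((1 - q ^ L) * R (q * \<kappa>) (Suc (N - L))))
      + \<kappa> ^ Suc N * G (Suc N) x * ((1 - q ^ Suc N) * R \<kappa> 0)"
    by (simp add: Suc_diff_le R_def)
  also have "(\<Sum>L=0..N. \<kappa> ^ L * G L x * (R (q * \<kappa>) (N - L) * (q ^ L - \<kappa>))) + \<dots>
      = (\<Sum>L=0..N. \<kappa> ^ L * G L x * ((1 - q ^ Suc N) * R \<kappa> (Suc (N - L))))
      + \<kappa> ^ Suc N * G (Suc N) x * ((1 - q ^ Suc N) * R \<kappa> 0)"
    unfolding add.assoc[symmetric] sum.distrib[symmetric] distrib_left[symmetric]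
    by (intro arg_cong2[where f = "(+)"] sum.cong refl) (simp add: coefficient)
  also have "\<dots> = (1 - q ^ Suc N) * (\<Sum>L=0..Suc N. \<kappa> ^ L * G L x * R \<kappa> (Suc N - L))"
    by (simp add: Suc_diff_le sum_distrib_left distrib_left mult_ac)
  finally show ?case
    using q(2)[of "Suc N"] unfolding G_def R_def by simp
qed

section \<open>Translation to the series Phi\<close>

lemma box_weight_scale:
  assumes "r \<noteq> 0"
  shows "box_weight q n (\<lambda>i. r * x i) \<gamma> = box_weight q n x \<gamma>"
  using Delta_scale[OF assms, of n "\<lambda>i. x i * q ^ \<gamma> i" x] assms
  by (simp add: box_weight_def mult.assoc mult.left_commute[of q])

text \<open>The scaling \<open>r\<close> is free because \<open>\<Phi>\<close> depends only on ratios of the variables. The transformation requires the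
denominators \<open>1 - w k * x i\<close> to be the same on both sides, so the variables of one
side must absorb the factor \<open>c / (x n * y m)\<close>.\<close>

lemma Phi_eq_box_sum:
  assumes "r \<noteq> 0"
  shows "Phi q n m N a x b y c = box_sum q n N (\<lambda>i. r * x i)
    (ratio_fn n m (\<lambda>j. a j / (r * x j)) (\<lambda>k. b k * y k / (r * x n * y m)) (\<lambda>k. c * y k / (r * x n * y m)))"
  unfolding Phi_def box_sum_def
proof (intro sum.cong refl)
  fix \<gamma>
  have "(\<Prod>s<\<gamma> i. ratio_fn n m (\<lambda>j. a j / (r * x j)) (\<lambda>k. b k * y k / (r * x n * y m))
        (\<lambda>k. c * y k / (r * x n * y m)) (r * x i * q ^ s))
      = (\<Prod>j\<in>{1..n}. qpoch q (a j * x i / x j) (\<gamma> i))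
        * (\<Prod>k\<in>{1..m}. qpoch q (b k * x i * y k / (x n * y m)) (\<gamma> i)
          / qpoch q (c * x i * y k / (x n * y m)) (\<gamma> i))" for i
  proof -
    have "(\<Prod>s<\<gamma> i. ratio_fn n m (\<lambda>j. a j / (r * x j)) (\<lambda>k. b k * y k / (r * x n * y m))
        (\<lambda>k. c * y k / (r * x n * y m)) (r * x i * q ^ s))
      = (\<Prod>s<\<gamma> i. (\<Prod>j\<in>{1..n}. 1 - a j * x i / x j * q ^ s)
        * (\<Prod>k\<in>{1..m}. (1 - b k * x i * y k / (x n * y m) * q ^ s) / (1 - c * x i * y k / (x n * y m) * q ^ s)))"
      unfolding ratio_fn_def using assms by (simp add: mult_ac)
    then show ?thesis
      unfolding qpoch_def prod.distrib prod_dividef[symmetric]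
      by (subst (asm) (2) prod.swap, subst (asm) prod.swap) (simp add: mult_ac)
  qed
  then show "Delta n (\<lambda>i. x i * q ^ \<gamma> i) / Delta n x
      * (\<Prod>i\<in>{1..n}. \<Prod>j\<in>{1..n}. qpoch q (a j * x i / x j) (\<gamma> i) / qpoch q (q * x i / x j) (\<gamma> i))
      * (\<Prod>i\<in>{1..n}. \<Prod>k\<in>{1..m}. qpoch q (b k * x i * y k / (x n * y m)) (\<gamma> i)
          / qpoch q (c * x i * y k / (x n * y m)) (\<gamma> i))
    = box_weight q n (\<lambda>i. r * x i) \<gamma> * (\<Prod>i\<in>{1..n}. \<Prod>s<\<gamma> i. ratio_fn n m (\<lambda>j. a j / (r * x j))
        (\<lambda>k. b k * y k / (r * x n * y m)) (\<lambda>k. c * y k / (r * x n * y m)) (r * x i * q ^ s))"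
    unfolding box_weight_scale[OF assms] box_weight_def by (simp add: prod.distrib prod_dividef)
qed

text \<open>The diagrams with all \<open>N\<close> boxes in one row already carry every denominator condition.\<close>

lemma Phi_generic_imp_separated:
  assumes gen: "Phi_generic q n m N x y c" and xnz: "\<And>i. i \<in> {1..n} \<Longrightarrow> x i \<noteq> 0"
  shows "separated q n N x"
    and "\<And>i k s. i \<in> {1..n} \<Longrightarrow> k \<in> {1..m} \<Longrightarrow> s < N \<Longrightarrow> c * x i * y k / (x n * y m) * q ^ s \<noteq> 1"
proof -
  have mem: "(\<lambda>j\<in>{1..n}. if j = i then N else 0) \<in> multi_indices n N" if "i \<in> {1..n}" for i
    using that by (auto simp: multi_indices_def)
  have gen_i: "qpoch q (q * x i / x j) N \<noteq> 0" "k \<in> {1..m} \<Longrightarrow> qpoch q (c * x i * y k / (x n * y m)) N \<noteq> 0"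
    if "i \<in> {1..n}" "j \<in> {1..n}" for i j k
    using gen mem[OF that(1)] that unfolding Phi_generic_def by force+
  show "separated q n N x"
    unfolding separated_def
  proof (intro conjI ballI allI impI)
    fix i j s assume i: "i \<in> {1..n}" and j: "j \<in> {1..n}" and s: "s \<le> N" and eq: "x i * q ^ s = x j"
    show s0: "s = 0"
    proof (rule ccontr)
      assume "s \<noteq> 0"
      then obtain t where t: "s = Suc t" by (cases s) auto
      then have "q * x i / x j * q ^ t = 1" using eq xnz[OF j] by (simp add: mult_ac)
      then show False using gen_i(1)[OF i j] s t by (auto simp: qpoch_eq_0_iff)
    qed
    have "inj_on x {1..n}" using gen by (simp add: Phi_generic_def Delta_nonzero_iff)
    then show "i = j" using eq s0 i j by (simp add: inj_on_eq_iff)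
  qed (rule xnz)
  show "c * x i * y k / (x n * y m) * q ^ s \<noteq> 1" if "i \<in> {1..n}" "k \<in> {1..m}" "s < N" for i k s
    using gen_i(2)[OF that(1,1,2)] that by (auto simp: qpoch_eq_0_iff)
qed

text \<open>With \<open>w k = c * y k / (x n * y m)\<close> the products \<open>x j * p j\<close> and the quotients \<open>v k / w k\<close> are \<open>a j\<close> and \<open>b k / c\<close>, which
gives \<open>\<kappa>\<close> its value \<open>A B / c\<^sup>m\<close>.\<close>

theorem Phi_euler_transformation:
  assumes q: "q \<noteq> 0" "\<And>s. s > 0 \<Longrightarrow> q ^ s \<noteq> 1" and "1 \<le> n" "1 \<le> m" "c \<noteq> 0"
    and ax: "\<And>i. i \<in> {1..n} \<Longrightarrow> a i \<noteq> 0 \<and> x i \<noteq> 0"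
    and byy: "\<And>k. k \<in> {1..m} \<Longrightarrow> b k \<noteq> 0 \<and> y k \<noteq> 0"
    and gen: "Phi_generic q n m N x y c" "Phi_generic q m n N y x c"
    and \<kappa>: "\<kappa> = (\<Prod>i\<in>{1..n}. a i) * (\<Prod>k\<in>{1..m}. b k) / c ^ m"
    and "M \<le> N"
  shows "Phi q n m M a x b y c
    = (\<Sum>L=0..M. \<kappa> ^ L * Phi q m n L (\<lambda>k. c / b k) y (\<lambda>i. c / a i) x c
        * (qpoch q \<kappa> (M - L) / qpoch q q (M - L)))"
proof -
  define r where "r = c / (x n * y m)"
  define p v w where "p = (\<lambda>j. a j / x j)" and "v = (\<lambda>k. b k * y k / (x n * y m))" and "w = (\<lambda>k. r * y k)"
  have last: "x n \<noteq> 0" "y m \<noteq> 0" using ax[of n] byy[of m] \<open>1 \<le> n\<close> \<open>1 \<le> m\<close> by auto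
  have r: "r \<noteq> 0" using last \<open>c \<noteq> 0\<close> by (simp add: r_def)
  have primal: "Phi q n m K a x b y c = box_sum q n K x (ratio_fn n m p v w)" for K
    using Phi_eq_box_sum[of 1 q n m K a x b y c] by (simp add: p_def v_def w_def r_def mult_ac)
  have dual: "Phi q m n K (\<lambda>k. c / b k) y (\<lambda>i. c / a i) x c
      = box_sum q m K w (ratio_fn m n (\<lambda>k. 1 / v k) (\<lambda>i. 1 / p i) x)" for K
  proof -
    have "(\<lambda>k. c / b k / (r * y k)) = (\<lambda>k. 1 / v k)" "(\<lambda>i. c / a i * x i / (r * y m * x n)) = (\<lambda>i. 1 / p i)"
      "(\<lambda>i. c * x i / (r * y m * x n)) = x"
      using last \<open>c \<noteq> 0\<close> by (auto simp: r_def v_def p_def mult_ac)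
    then show ?thesis using Phi_eq_box_sum[OF r, of q m n K "\<lambda>k. c / b k" y "\<lambda>i. c / a i" x c]
      by (simp add: w_def)
  qed
  note sep_x = Phi_generic_imp_separated[OF gen(1)] and sep_y = Phi_generic_imp_separated[OF gen(2)]
  have wsep: "separated q m M w"
    unfolding w_def by (intro separated_scale r separated_mono[OF sep_y(1) \<open>M \<le> N\<close>]) (use byy in auto)
  show ?thesis
    unfolding primal dual
  proof (rule euler_transformation[OF q])
    show "separated q n M x" by (rule separated_mono[OF sep_x(1) \<open>M \<le> N\<close>]) (use ax in auto)
    show "x i * w k * q ^ s \<noteq> 1" if "i \<in> {1..n}" "k \<in> {1..m}" "s < M" for i k s
      using sep_x(2)[of i k s] ax that \<open>M \<le> N\<close> by (simp add: w_def r_def mult_ac)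
    have "v k / w k = b k / c" if "k \<in> {1..m}" for k
      using byy[OF that] last by (simp add: v_def w_def r_def)
    then show "\<kappa> = (\<Prod>j\<in>{1..n}. p j * x j) * (\<Prod>k\<in>{1..m}. v k / w k)"
      using ax by (simp add: \<kappa> p_def prod_dividef)
  qed (use ax byy last wsep in \<open>auto simp: p_def v_def\<close>)
qed

section \<open>The product of two transformations\<close>

lemma sum_convolution_assoc:
  fixes g r h :: "nat \<Rightarrow> 'a::comm_semiring_1"
  shows "(\<Sum>K=0..N. (\<Sum>L=0..K. g L * r (K - L)) * h (N - K))
    = (\<Sum>L=0..N. g L * (\<Sum>M=0..N - L. h M * r (N - L - M)))"
proof -
  have "fps_nth (Abs_fps g * Abs_fps r * Abs_fps h) N = fps_nth (Abs_fps g * (Abs_fps h * Abs_fps r)) N"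
    by (simp only: mult_ac)
  then show ?thesis by (simp add: fps_mult_nth)
qed

theorem theorem3p1:
  fixes q c f :: complex
    and n1 m1 n2 m2 N :: nat
    and a x b y d w e z :: "nat \<Rightarrow> complex"
    and A B D E :: complex
  assumes q: "0 < norm q" "norm q < 1"
    and pos: "1 \<le> n1" "1 \<le> m1" "1 \<le> n2" "1 \<le> m2"
    and nonzero_ax: "\<forall>i\<in>{1..n1}. a i \<noteq> 0 \<and> x i \<noteq> 0"
    and nonzero_by: "\<forall>k\<in>{1..m1}. b k \<noteq> 0 \<and> y k \<noteq> 0"
    and nonzero_dw: "\<forall>s\<in>{1..m2}. d s \<noteq> 0 \<and> w s \<noteq> 0"
    and nonzero_ez: "\<forall>p\<in>{1..n2}. e p \<noteq> 0 \<and> z p \<noteq> 0"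
    and nonzero_cf: "c \<noteq> 0" "f \<noteq> 0"
    and generic_xy: "\<forall>K\<le>N. Phi_generic q n1 m1 K x y c"
    and generic_zw: "\<forall>K\<le>N. Phi_generic q n2 m2 (N - K) z w f"
    and generic_yx: "\<forall>L\<le>N. Phi_generic q m1 n1 L y x c"
    and generic_wz: "\<forall>L\<le>N. Phi_generic q m2 n2 (N - L) w z f"
    and A: "A = (\<Prod>i\<in>{1..n1}. a i)"
    and B: "B = (\<Prod>k\<in>{1..m1}. b k)"
    and D: "D = (\<Prod>s\<in>{1..m2}. d s)"
    and E: "E = (\<Prod>p\<in>{1..n2}. e p)"
    and balancing: "A * B / c ^ m1 = D * E / f ^ n2"
  shows "(\<Sum>K\<in>{0..N}.
            Phi q n1 m1 K a x b y c
            * Phi q n2 m2 (N - K) (\<lambda>p. f / e p) z (\<lambda>s. f / d s) w f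
            * (D * E / f ^ n2) ^ (N - K))
       = (\<Sum>L\<in>{0..N}.
            Phi q m1 n1 L (\<lambda>k. c / b k) y (\<lambda>i. c / a i) x c
            * Phi q m2 n2 (N - L) d w e z f
            * (A * B / c ^ m1) ^ L)"
proof -
  define \<kappa> where "\<kappa> = A * B / c ^ m1"
  define R where "R k = qpoch q \<kappa> k / qpoch q q k" for k
  define g where "g L = \<kappa> ^ L * Phi q m1 n1 L (\<lambda>k. c / b k) y (\<lambda>i. c / a i) x c" for L
  define h where "h M = \<kappa> ^ M * Phi q n2 m2 M (\<lambda>p. f / e p) z (\<lambda>s. f / d s) w f" for M
  have \<kappa>': "D * E / f ^ n2 = \<kappa>" by (simp add: \<kappa>_def balancing)
  have q0: "q \<noteq> 0" using q(1) by auto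
  have q1: "q ^ s \<noteq> 1" if "s > 0" for s
  proof
    assume "q ^ s = 1"
    then have "norm q ^ s = 1" by (metis norm_one norm_power)
    then show False using q that by (metis norm_ge_zero power_Suc_less_one less_irrefl gr0_implies_Suc)
  qed
  have first: "Phi q n1 m1 K a x b y c = (\<Sum>L=0..K. g L * R (K - L))" if "K \<le> N" for K
    unfolding g_def R_def
    by (rule Phi_euler_transformation[where N = N, OF q0 q1])
      (use assms that in \<open>auto simp: \<kappa>_def\<close>)
  have second: "Phi q m2 n2 K d w e z f = (\<Sum>M=0..K. h M * R (K - M))" if "K \<le> N" for K
    unfolding h_def R_def
    by (rule Phi_euler_transformation[where N = N, OF q0 q1])
      (use assms(3-14) generic_zw[rule_format, of 0] generic_wz[rule_format, of 0] that
        in \<open>auto simp: \<kappa>'[symmetric] D E\<close>)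
  have "(\<Sum>K=0..N. Phi q n1 m1 K a x b y c
            * Phi q n2 m2 (N - K) (\<lambda>p. f / e p) z (\<lambda>s. f / d s) w f * \<kappa> ^ (N - K))
      = (\<Sum>K=0..N. (\<Sum>L=0..K. g L * R (K - L)) * h (N - K))"
    by (intro sum.cong refl) (simp add: first h_def mult_ac)
  also have "\<dots> = (\<Sum>L=0..N. g L * (\<Sum>M=0..N - L. h M * R (N - L - M)))"
    by (rule sum_convolution_assoc)
  also have "\<dots> = (\<Sum>L=0..N. Phi q m1 n1 L (\<lambda>k. c / b k) y (\<lambda>i. c / a i) x c
            * Phi q m2 n2 (N - L) d w e z f * \<kappa> ^ L)"
    by (intro sum.cong refl) (simp add: second g_def mult_ac)
  finally show ?thesis unfolding \<kappa>' \<kappa>_def[symmetric] .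
qed

end
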